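(* The maps $\pi:\mathcal O_\theta\to\widehat{\mathcal O}_\theta$ and ${}':\mathcal O_\theta\to\mathbb R$ are surjective and satisfy, for all $x,y\in\mathcal O_\theta$, $\pi(x+y)=\{\pi(x)+\pi(y)\}$, $\pi(x\cdot y)=\{\pi(x)\pi(y)\}$, and $(x+y)'=\{x'+y'\}$, $(x\cdot y)'=\{x'y'\}$ (images of sets taken elementwise); that is, they are epimorphisms of Marty multirings.
   Context: $\theta>1$ is a real quadratic unit with $N(\theta)=-1$, so $\theta^2=a\theta+1$ with an integer $a\ge1$; $K=\mathbb Q(\theta)\subset\mathbb R$, $\mathcal O_K$ its ring of integers, $\alpha'$ the Galois conjugate of $\alpha\in K$. A greedy polynomial is a finite sum $\sum_{i=m}^M b_i\theta^i$ with $b_i\in\{0,\dots,a\}$ such that $b_i=a$ implies $b_{i-1}=0$; every nonzero $\alpha\in\mathcal O_K$ is uniquely $\pm$ such a sum with $b_m\ne0$, and $|\alpha|_\theta:=\theta^{-m}$, $|0|_\theta=0$. Completion: $\mathcal R_\theta$ is the ring (componentwise operations) of sequences in $\mathcal O_K$ that are Cauchy for $|\cdot|_\theta$, $\mathcal M_\theta$ the ideal of sequences with $|f_n|_\theta\to0$, and $\widehat{\mathcal O}_\theta=\mathcal R_\theta/\mathcal M_\theta$. For any Cauchy sequence $(f_n)$ the real sequence $(f_n')$ converges, with limit depending only on the class $\hat f$; write $\hat f'$ for it. $\theta$-adic numbers: a greedy Laurent series is a formal series $x=\sum_{i\ge m}b_i\theta^i$ with $b_i\in\{0,\dots,a\}$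 such that every truncation is a greedy polynomial. A sequence $(x_n)$ in $\mathcal O_K$ is a sequence of partial sums of $x$ if there are integers $M_n$, nondecreasing, $M_n\to\infty$, with $x_n=\sum_{i=m}^{M_n}b_i\theta^i+\delta_n$, $\delta_n$ a greedy polynomial involving only powers $\theta^j$, $j>M_n$. $\mathcal O_\theta^+$ is the set of greedy Laurent series and $\mathcal O_\theta=\mathcal O_\theta^+\cup(-\mathcal O_\theta^+)$, with partial sums of $-x$ the negatives of those of $x$, the zero series and its negative identified. Multioperations: $w\in x+y$ (resp. $w\in x\cdot y$) iff there are sequences of partial sums $(x_n)$ of $x$, $(y_n)$ of $y$ with $(x_n+y_n)$ (resp. $(x_ny_n)$) a sequence of partial sums of $w$. All sequences of partial sums of a given $x\in\mathcal O_\theta$ are Cauchy and define the same class $\pi(x)\in\widehat{\mathcal O}_\theta$; put $x':=\pi(x)'\in\mathbb R$.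
   Formalization: Greedy expansions of all nonzero elements of O_K exist only if O_K = Z[θ] (false for a = 4, where (θ−1)/2 has none), so the result is stated for O_K when all its nonzero elements have such expansions, and for Z[θ] in place of O_K for every θ. *)

theory Defs
  imports
    Complex_Main
    "HOL-Algebra.QuotRing"
    "HOL-Computational_Algebra.Formal_Laurent_Series"
begin

section \<open>The quadratic field, its ring of integers, conjugation\<close>

definition quad_field :: "real \<Rightarrow> real set" where
  "quad_field \<theta> = {of_rat u + of_rat v * \<theta> | u v. True}"

definition ring_of_integers :: "real \<Rightarrow> real set" where
  "ring_of_integers \<theta> = {\<alpha> \<in> quad_field \<theta>. algebraic_int \<alpha>}"

definition quad_order :: "real \<Rightarrow> real set" where
  "quad_order \<theta> = {of_int u + of_int v * \<theta> | u v. True}"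

text \<open>As \<open>\<theta>\<close> has norm \<open>-1\<close>, its Galois conjugate is \<open>-1/\<theta>\<close>.\<close>

definition quad_conj :: "real \<Rightarrow> real \<Rightarrow> real" where
  "quad_conj \<theta> \<alpha> =
     (THE c. \<exists>u v. \<alpha> = of_rat u + of_rat v * \<theta> \<and> c = of_rat u + of_rat v * (- 1 / \<theta>))"


section \<open>Greedy polynomials and the absolute value\<close>

text \<open>
  \<open>greedy_poly a m M b\<close>: the digits \<open>b\<close> vanish outside \<open>{m..M}\<close> and are greedy.
  The case \<open>M < m\<close> is the empty sum.
\<close>

definition greedy_poly :: "int \<Rightarrow> int \<Rightarrow> int \<Rightarrow> (int \<Rightarrow> int) \<Rightarrow> bool" where
  "greedy_poly a m M b \<longleftrightarrow>
     (\<forall>i. i \<notin> {m..M} \<longrightarrow> b i = 0) \<and>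
     (\<forall>i. b i \<in> {0..a}) \<and>
     (\<forall>i. b i = a \<longrightarrow> b (i - 1) = 0)"

definition digit_sum :: "real \<Rightarrow> int \<Rightarrow> int \<Rightarrow> (int \<Rightarrow> int) \<Rightarrow> real" where
  "digit_sum \<theta> m M b = (\<Sum>i = m..M. of_int (b i) * \<theta> powi i)"

text \<open>\<open>\<alpha>\<close> is, up to sign, a greedy polynomial with lowest term in degree exactly \<open>m\<close>.\<close>

definition greedy_expansion :: "real \<Rightarrow> int \<Rightarrow> real \<Rightarrow> int \<Rightarrow> bool" where
  "greedy_expansion \<theta> a \<alpha> m \<longleftrightarrow>
     (\<exists>M b. greedy_poly a m M b \<and> b m \<noteq> 0 \<and>
            (\<alpha> = digit_sum \<theta> m M b \<or> \<alpha> = - digit_sum \<theta> m M b))"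

definition theta_abs :: "real \<Rightarrow> int \<Rightarrow> real \<Rightarrow> real" where
  "theta_abs \<theta> a \<alpha> =
     (if \<alpha> = 0 then 0 else (THE r. \<exists>m. greedy_expansion \<theta> a \<alpha> m \<and> r = \<theta> powi (- m)))"


section \<open>The completion\<close>

text \<open>
  \<open>A\<close> is the ring to be completed. It is a parameter because greedy polynomials lie in
  \<open>quad_order \<theta>\<close>, which may be smaller than \<open>ring_of_integers \<theta>\<close> (for instance when
  \<open>a = 4\<close>, where \<open>(\<theta> - 1) / 2\<close> is an algebraic integer); elements outside \<open>quad_order \<theta>\<close> have
  no greedy expansion and no value \<open>theta_abs\<close>.
\<close>

definition theta_Cauchy :: "real set \<Rightarrow> real \<Rightarrow> int \<Rightarrow> (nat \<Rightarrow> real) \<Rightarrow> bool" where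
  "theta_Cauchy A \<theta> a f \<longleftrightarrow>
     (\<forall>n. f n \<in> A) \<and>
     (\<forall>\<epsilon>>0. \<exists>N. \<forall>m\<ge>N. \<forall>n\<ge>N. theta_abs \<theta> a (f m - f n) < \<epsilon>)"

definition cauchy_ring :: "real set \<Rightarrow> real \<Rightarrow> int \<Rightarrow> (nat \<Rightarrow> real) ring" where
  "cauchy_ring A \<theta> a =
     \<lparr>carrier = {f. theta_Cauchy A \<theta> a f},
      monoid.mult = (\<lambda>f g n. f n * g n), one = (\<lambda>n. 1),
      zero = (\<lambda>n. 0), add = (\<lambda>f g n. f n + g n)\<rparr>"

definition null_ideal :: "real set \<Rightarrow> real \<Rightarrow> int \<Rightarrow> (nat \<Rightarrow> real) set" where
  "null_ideal A \<theta> a =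
     {f \<in> carrier (cauchy_ring A \<theta> a). (\<lambda>n. theta_abs \<theta> a (f n)) \<longlonglongrightarrow> 0}"

definition completion :: "real set \<Rightarrow> real \<Rightarrow> int \<Rightarrow> (nat \<Rightarrow> real) set ring" where
  "completion A \<theta> a = cauchy_ring A \<theta> a Quot null_ideal A \<theta> a"

definition completion_conj :: "real \<Rightarrow> (nat \<Rightarrow> real) set \<Rightarrow> real" where
  "completion_conj \<theta> c = (THE r. \<forall>f\<in>c. (\<lambda>n. quad_conj \<theta> (f n)) \<longlonglongrightarrow> r)"


section \<open>Theta-adic numbers\<close>

text \<open>
  A formal series in powers of \<open>\<theta>\<close> is an integral formal Laurent series, the variable
  standing for \<open>\<theta>\<close>. Negation then changes the sign of every digit, which makes the zero
  series equal to its negative.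
\<close>

definition greedy_laurent :: "int \<Rightarrow> int fls set" where
  "greedy_laurent a =
     {x. \<forall>M. greedy_poly a (fls_subdegree x) M (\<lambda>i. if i \<le> M then fls_nth x i else 0)}"

definition theta_adic :: "int \<Rightarrow> int fls set" where
  "theta_adic a = greedy_laurent a \<union> uminus ` greedy_laurent a"

definition greedy_partial_sums :: "real \<Rightarrow> int \<Rightarrow> int fls \<Rightarrow> (nat \<Rightarrow> real) \<Rightarrow> bool" where
  "greedy_partial_sums \<theta> a x f \<longleftrightarrow>
     (\<exists>M :: nat \<Rightarrow> int. mono M \<and> filterlim M at_top sequentially \<and>
        (\<forall>n. \<exists>N d. greedy_poly a (M n + 1) N d \<and>
           f n = digit_sum \<theta> (fls_subdegree x) (M n) (fls_nth x) + digit_sum \<theta> (M n + 1) N d))"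

text \<open>
  The two disjuncts overlap only for \<open>x = 0\<close>, whose sequences of partial sums are thus those
  of the zero series together with their negatives.
\<close>

definition partial_sums :: "real set \<Rightarrow> real \<Rightarrow> int \<Rightarrow> int fls \<Rightarrow> (nat \<Rightarrow> real) \<Rightarrow> bool" where
  "partial_sums A \<theta> a x f \<longleftrightarrow>
     (\<forall>n. f n \<in> A) \<and>
     (x \<in> greedy_laurent a \<and> greedy_partial_sums \<theta> a x f \<or>
      - x \<in> greedy_laurent a \<and> greedy_partial_sums \<theta> a (- x) (\<lambda>n. - f n))"

definition multi_add :: "real set \<Rightarrow> real \<Rightarrow> int \<Rightarrow> int fls \<Rightarrow> int fls \<Rightarrow> int fls set" where
  "multi_add A \<theta> a x y =
     {w \<in> theta_adic a. \<exists>f g. partial_sums A \<theta> a x f \<and> partial_sums A \<theta> a y g \<and>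
                              partial_sums A \<theta> a w (\<lambda>n. f n + g n)}"

definition multi_mult :: "real set \<Rightarrow> real \<Rightarrow> int \<Rightarrow> int fls \<Rightarrow> int fls \<Rightarrow> int fls set" where
  "multi_mult A \<theta> a x y =
     {w \<in> theta_adic a. \<exists>f g. partial_sums A \<theta> a x f \<and> partial_sums A \<theta> a y g \<and>
                              partial_sums A \<theta> a w (\<lambda>n. f n * g n)}"

definition theta_pi :: "real set \<Rightarrow> real \<Rightarrow> int \<Rightarrow> int fls \<Rightarrow> (nat \<Rightarrow> real) set" where
  "theta_pi A \<theta> a x =
     (THE c. c \<in> carrier (completion A \<theta> a) \<and> (\<forall>f. partial_sums A \<theta> a x f \<longrightarrow> f \<in> c))"

definition theta_conj :: "real set \<Rightarrow> real \<Rightarrow> int \<Rightarrow> int fls \<Rightarrow> real" where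
  "theta_conj A \<theta> a x = completion_conj \<theta> (theta_pi A \<theta> a x)"

end

theory Submission imports Defs begin

text \<open>
  Everything is controlled by the Galois conjugate. For a greedy polynomial with lowest term
  \<open>b m \<theta>\<^sup>m\<close>, the alternating sum \<open>\<Sum>i. b i \<kappa>\<^sup>i\<close> with \<open>\<kappa> = - 1 / \<theta>\<close> lies strictly between
  \<open>\<theta>\<^sup>-\<^sup>m / \<theta>\<close> and \<open>\<theta>\<^sup>-\<^sup>m \<theta>\<close> in absolute value, and it has the sign of \<open>(-1)\<^sup>m\<close>. Hence \<open>m\<close> is
  determined by the number, and the theta-adic absolute value of \<open>\<alpha>\<close> is comparable to the ordinary
  absolute value of its conjugate. As the conjugates are dense in the reals, the completion is the
  real line: its classes are the sets of all sequences with a given limit of conjugates, and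
  \<open>\<pi>(x)\<close> is the class of the convergent series \<open>x'\<close>. What remains is a compactness argument: there
  are finitely many digits, so a sequence with bounded conjugates has a subsequence whose
  expansions stabilise digit by digit, which makes it a sequence of partial sums of some
  theta-adic number. This gives surjectivity and nonempty sums and products.
\<close>

section \<open>Finite digit sums: shifting, padding, splitting\<close>

lemma digit_sum_shift:
  assumes "\<theta> \<noteq> 0"
  shows "digit_sum \<theta> (m + k) (M + k) (\<lambda>i. b (i - k)) = \<theta> powi k * digit_sum \<theta> m M b"
proof -
  have "digit_sum \<theta> (m + k) (M + k) (\<lambda>i. b (i - k)) = (\<Sum>i = m..M. of_int (b i) * \<theta> powi (i + k))"
    unfolding digit_sum_def
    by (rule sum.reindex_bij_witness[of _ "\<lambda>i. i + k" "\<lambda>i. i - k"]) auto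
  then show ?thesis
    using assms by (simp add: digit_sum_def sum_distrib_left power_int_add mult_ac)
qed

lemma digit_sum_lower:
  assumes "m \<le> m'" and "\<And>i. m \<le> i \<Longrightarrow> i < m' \<Longrightarrow> b i = 0"
  shows "digit_sum \<theta> m M b = digit_sum \<theta> m' M b"
  unfolding digit_sum_def
  by (rule sum.mono_neutral_right) (use assms in auto)

lemma digit_sum_upper:
  assumes "M' \<le> M" and "\<And>i. M' < i \<Longrightarrow> i \<le> M \<Longrightarrow> b i = 0"
  shows "digit_sum \<theta> m M b = digit_sum \<theta> m M' b"
  unfolding digit_sum_def
  by (rule sum.mono_neutral_right) (use assms in auto)

lemma digit_sum_split:
  assumes "m \<le> k + 1" "k \<le> M"
  shows "digit_sum \<theta> m M b = digit_sum \<theta> m k b + digit_sum \<theta> (k + 1) M b"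
proof -
  have "{m..M} = {m..k} \<union> {k + 1..M}"
    using assms by auto
  then show ?thesis
    unfolding digit_sum_def by (simp add: sum.union_disjoint)
qed

lemma digit_sum_cong:
  assumes "\<And>i. m \<le> i \<Longrightarrow> i \<le> M \<Longrightarrow> b i = b' i"
  shows "digit_sum \<theta> m M b = digit_sum \<theta> m M b'"
  unfolding digit_sum_def by (rule sum.cong) (use assms in auto)

lemma digit_sum_zero [simp]: "digit_sum \<theta> m M (\<lambda>_. 0) = 0"
  by (simp add: digit_sum_def)

lemma digit_sum_empty [simp]: "M < m \<Longrightarrow> digit_sum \<theta> m M b = 0"
  by (simp add: digit_sum_def)

lemma digit_sum_rec:
  "m \<le> M \<Longrightarrow> digit_sum \<theta> m M b = of_int (b m) * \<theta> powi m + digit_sum \<theta> (m + 1) M b"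
  by (subst digit_sum_split[of m m]) (auto simp: digit_sum_def)

lemma digit_sum_nonneg:
  assumes "\<theta> \<ge> 0" "\<And>i. b i \<ge> 0"
  shows "digit_sum \<theta> m M b \<ge> 0"
  unfolding digit_sum_def using assms by (intro sum_nonneg) (auto intro: mult_nonneg_nonneg)

section \<open>Greedy digit conditions, stabilising subsequences, greedy Laurent series\<close>

definition greedy_digits :: "int \<Rightarrow> (int \<Rightarrow> int) \<Rightarrow> bool" where
  "greedy_digits a b \<longleftrightarrow> (\<forall>i. b i \<in> {0..a} \<and> (b i = a \<longrightarrow> b (i - 1) = 0))"

lemma greedy_poly_iff:
  "greedy_poly a m M b \<longleftrightarrow> greedy_digits a b \<and> (\<forall>i. i \<notin> {m..M} \<longrightarrow> b i = 0)"
  by (auto simp: greedy_poly_def greedy_digits_def)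

text \<open>Diagonal argument: the pigeonhole principle gives nested infinite index sets
  \<open>S k\<close> on which the coordinates below \<open>k\<close> are constant. Choosing
  \<open>\<phi> k\<close> increasing in \<open>S (Suc k)\<close> fixes all coordinates up to and
  including \<open>k\<close>.\<close>

lemma subseq_stable_values:
  fixes B :: "nat \<Rightarrow> nat \<Rightarrow> 'a"
  assumes "\<And>i. finite (range (\<lambda>n. B n i))"
  obtains \<phi> c where "strict_mono \<phi>" "\<And>k i. i \<le> k \<Longrightarrow> B (\<phi> k) i = c i"
proof -
  define P where "P k S \<longleftrightarrow> infinite S \<and> (\<forall>n\<in>S. \<forall>n'\<in>S. \<forall>i<k. B n i = B n' i)" for k S
  have "\<exists>S. \<forall>k. P k (S k) \<and> S (Suc k) \<subseteq> S k"
  proof (rule dependent_nat_choice)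
    show "\<exists>S. P 0 S"
      by (auto simp: P_def intro: exI[of _ UNIV])
  next
    fix S k
    assume S: "P k S"
    have "finite ((\<lambda>n. B n k) ` S)"
      by (rule finite_subset[OF _ assms[of k]]) auto
    then obtain n0 where "infinite {n \<in> S. B n k = B n0 k}"
      using S pigeonhole_infinite[of S "\<lambda>n. B n k"] by (auto simp: P_def)
    then have "P (Suc k) {n \<in> S. B n k = B n0 k}"
      using S by (auto simp: P_def less_Suc_eq)
    then show "\<exists>S'. P (Suc k) S' \<and> S' \<subseteq> S"
      by blast
  qed
  then obtain S where S: "\<And>k. P k (S k)" "\<And>k. S (Suc k) \<subseteq> S k"
    by blast
  have anti: "S l \<subseteq> S k" if "k \<le> l" for k l
    using that S(2) by (rule lift_Suc_antimono_le[rotated])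
  have "\<exists>\<phi>. \<forall>k. \<phi> k \<in> S (Suc k) \<and> \<phi> k < \<phi> (Suc k)"
  proof (rule dependent_nat_choice)
    have "infinite (S (Suc 0))"
      using S(1) by (auto simp: P_def)
    then show "\<exists>n. n \<in> S (Suc 0)"
      using infinite_imp_nonempty by blast
  next
    fix n k
    have "infinite (S (Suc (Suc k)))"
      using S(1) by (auto simp: P_def)
    then show "\<exists>n'. n' \<in> S (Suc (Suc k)) \<and> n < n'"
      by (auto simp: infinite_nat_iff_unbounded)
  qed
  then obtain \<phi> where \<phi>: "\<And>k. \<phi> k \<in> S (Suc k)" "\<And>k. \<phi> k < \<phi> (Suc k)"
    by blast
  have "B (\<phi> k) i = B (\<phi> i) i" if "i \<le> k" for i k
  proof -
    have "\<phi> k \<in> S (Suc i)"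
      using \<phi>(1) anti[of "Suc i" "Suc k"] that by auto
    moreover have "\<forall>n\<in>S (Suc i). \<forall>n'\<in>S (Suc i). B n i = B n' i"
      using S(1)[of "Suc i"] unfolding P_def by blast
    ultimately show ?thesis
      using \<phi>(1)[of i] by blast
  qed
  moreover have "strict_mono \<phi>"
    using \<phi>(2) by (simp add: strict_mono_Suc_iff)
  ultimately show thesis
    using that[of \<phi> "\<lambda>i. B (\<phi> i) i"] by blast
qed

text \<open>The greedy condition only relates neighbouring digits, so it can be tested on the whole
  series at once. Since \<open>0 \<noteq> a\<close>, the zeros that a truncation puts above its cut
  impose nothing on the digits below.\<close>

lemma greedy_laurent_iff:
  assumes "a \<ge> 1"
  shows "x \<in> greedy_laurent a \<longleftrightarrow> greedy_digits a (fls_nth x)"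
proof
  assume x: "x \<in> greedy_laurent a"
  show "greedy_digits a (fls_nth x)"
    unfolding greedy_digits_def
  proof
    fix i
    have "greedy_poly a (fls_subdegree x) i (\<lambda>j. if j \<le> i then fls_nth x j else 0)"
      using x by (simp add: greedy_laurent_def)
    then show "fls_nth x i \<in> {0..a} \<and> (fls_nth x i = a \<longrightarrow> fls_nth x (i - 1) = 0)"
      unfolding greedy_poly_iff greedy_digits_def by (auto dest!: spec[of _ i])
  qed
next
  assume "greedy_digits a (fls_nth x)"
  then show "x \<in> greedy_laurent a"
    using assms by (auto simp: greedy_laurent_def greedy_poly_iff greedy_digits_def)
qed

lemma theta_adic_digit_bound:
  assumes "a \<ge> 1" "x \<in> theta_adic a"
  shows "\<bar>fls_nth x i\<bar> \<le> a"
  using assms by (auto simp: theta_adic_def greedy_laurent_iff greedy_digits_def)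

lemma theta_adic_uminus: "- x \<in> theta_adic a \<longleftrightarrow> x \<in> theta_adic a"
proof -
  have "- x \<in> theta_adic a" if "x \<in> theta_adic a" for x
    using that by (auto simp: theta_adic_def)
  from this[of x] this[of "- x"] show ?thesis by auto
qed

text \<open>Thinning out the sequence thins out the cut positions \<open>M\<close>, which stay
  monotone and unbounded.\<close>

lemma greedy_partial_sums_subseq:
  assumes "greedy_partial_sums \<theta> a x f" "strict_mono \<phi>"
  shows "greedy_partial_sums \<theta> a x (f \<circ> \<phi>)"
proof -
  obtain M where M: "mono M" "filterlim M at_top sequentially"
    and f: "\<And>n. \<exists>N d. greedy_poly a (M n + 1) N d \<and>
           f n = digit_sum \<theta> (fls_subdegree x) (M n) (fls_nth x) + digit_sum \<theta> (M n + 1) N d"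
    using assms(1) unfolding greedy_partial_sums_def by blast
  have "mono (M \<circ> \<phi>)"
    using M(1) assms(2) by (auto simp: mono_def strict_mono_less_eq)
  moreover have "filterlim (M \<circ> \<phi>) at_top sequentially"
    unfolding comp_def using M(2) filterlim_subseq[OF assms(2)] by (rule filterlim_compose)
  ultimately show ?thesis
    unfolding greedy_partial_sums_def using f by (intro exI[of _ "M \<circ> \<phi>"]) auto
qed

lemma partial_sums_subseq:
  assumes "partial_sums A \<theta> a x f" "strict_mono \<phi>"
  shows "partial_sums A \<theta> a x (f \<circ> \<phi>)"
  using assms greedy_partial_sums_subseq[of \<theta> a x f \<phi>]
    greedy_partial_sums_subseq[of \<theta> a "- x" "\<lambda>n. - f n" \<phi>]
  by (auto simp: partial_sums_def comp_def)

section \<open>The quadratic unit, its order, and conjugation\<close>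

locale quadratic_unit =
  fixes \<theta> :: real and a :: int
  assumes a_pos: "a \<ge> 1" and theta_gt_1: "\<theta> > 1"
    and theta_square: "\<theta>\<^sup>2 = of_int a * \<theta> + 1"
begin

definition \<kappa> :: real where "\<kappa> = - 1 / \<theta>"

lemma theta_eq: "\<theta> = of_int a + 1 / \<theta>"
  using theta_square theta_gt_1 by (simp add: field_simps power2_eq_square)

lemma kappa_eq: "\<kappa> = of_int a - \<theta>"
  using theta_eq by (simp add: \<kappa>_def)

lemma kappa_mult [simp]: "\<kappa> * x = - (x / \<theta>)"
  by (simp add: \<kappa>_def)

lemma kappa_nonzero [simp]: "\<kappa> \<noteq> 0"
  using theta_gt_1 by (simp add: \<kappa>_def)

lemma abs_kappa_powi: "\<bar>\<kappa> powi m\<bar> = \<theta> powi (- m)"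
  using theta_gt_1 by (simp add: \<kappa>_def power_int_abs power_int_minus power_int_one_over inverse_eq_divide)

lemma theta_bounds: "of_int a < \<theta>" "\<theta> < of_int a + 1"
proof -
  have "0 < 1 / \<theta>" "1 / \<theta> < 1"
    using theta_gt_1 by auto
  then show "of_int a < \<theta>" "\<theta> < of_int a + 1"
    using theta_eq by linarith+
qed

lemma floor_theta: "\<lfloor>\<theta>\<rfloor> = a"
  using theta_bounds by (intro floor_unique) auto

text \<open>A rational algebraic integer is an integer, but \<theta> lies strictly between
  \<open>a\<close> and \<open>a + 1\<close>.\<close>

lemma theta_irrational: "\<theta> \<notin> \<rat>"
proof
  assume rat: "\<theta> \<in> \<rat>"
  have "poly [:-1, - of_int a, 1:] \<theta> = 0"
    using theta_square by (simp add: algebra_simps power2_eq_square)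
  moreover have "\<forall>i. coeff [:-1, - of_int a, 1 :: real:] i \<in> \<int>"
    by (auto simp: coeff_pCons split: nat.splits)
  ultimately have "algebraic_int \<theta>"
    by (intro algebraic_int.intros[of "[:-1, - of_int a, 1:]"]) auto
  with rat have "\<theta> \<in> \<int>"
    by (rule rational_algebraic_int_is_int[rotated])
  then obtain k where "\<theta> = of_int k"
    by (elim Ints_cases)
  with theta_bounds show False
    by simp
qed

text \<open>Linear independence of 1 and \<theta> over the rationals; it makes the definite
  description in \<open>quad_conj\<close> meaningful.\<close>

lemma quad_field_unique:
  assumes "of_rat u + of_rat v * \<theta> = of_rat u' + of_rat v' * \<theta>"
  shows "u = u' \<and> v = v'"
proof -
  have eq: "of_rat (v - v') * \<theta> = of_rat (u' - u)"
    using assms by (simp add: of_rat_diff algebra_simps)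
  have "v = v'"
  proof (rule ccontr)
    assume "v \<noteq> v'"
    then have "\<theta> = of_rat ((u' - u) / (v - v'))"
      using eq by (simp add: of_rat_divide field_simps)
    then show False
      using theta_irrational Rats_of_rat by metis
  qed
  with eq show ?thesis by simp
qed

lemma quad_conj_of_int:
  "quad_conj \<theta> (of_int u + of_int v * \<theta>) = of_int u + of_int v * \<kappa>"
  unfolding quad_conj_def \<kappa>_def[symmetric]
proof (rule the_equality)
  show "\<exists>u' v'. of_int u + of_int v * \<theta> = of_rat u' + of_rat v' * \<theta> \<and>
        of_int u + of_int v * \<kappa> = of_rat u' + of_rat v' * \<kappa>"
    by (intro exI[of _ "of_int u"] exI[of _ "of_int v"]) simp
next
  fix c
  assume "\<exists>u' v'. of_int u + of_int v * \<theta> = of_rat u' + of_rat v' * \<theta> \<and>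
        c = of_rat u' + of_rat v' * \<kappa>"
  then obtain u' v' where
    "of_rat (of_int u) + of_rat (of_int v) * \<theta> = of_rat u' + of_rat v' * \<theta>"
    and c: "c = of_rat u' + of_rat v' * \<kappa>"
    by auto
  from quad_field_unique[OF this(1)] c show "c = of_int u + of_int v * \<kappa>"
    by auto
qed

lemma quad_orderI: "x = of_int u + of_int v * \<theta> \<Longrightarrow> x \<in> quad_order \<theta>"
  by (auto simp: quad_order_def)

lemma quad_orderE:
  assumes "x \<in> quad_order \<theta>"
  obtains u v where "x = of_int u + of_int v * \<theta>" "quad_conj \<theta> x = of_int u + of_int v * \<kappa>"
  using assms quad_conj_of_int by (auto simp: quad_order_def)

lemma of_int_quad_order [simp]: "of_int u \<in> quad_order \<theta>"
  by (rule quad_orderI[of _ u 0]) simp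

lemma quad_conj_int [simp]: "quad_conj \<theta> (of_int u) = of_int u"
  using quad_conj_of_int[of u 0] by simp

lemma zero_quad_order [simp]: "0 \<in> quad_order \<theta>" "quad_conj \<theta> 0 = 0"
  using of_int_quad_order[of 0] quad_conj_int[of 0] by simp_all

lemma one_quad_order [simp]: "1 \<in> quad_order \<theta>" "quad_conj \<theta> 1 = 1"
  using of_int_quad_order[of 1] quad_conj_int[of 1] by simp_all

lemma theta_quad_order [simp]: "\<theta> \<in> quad_order \<theta>" "quad_conj \<theta> \<theta> = \<kappa>"
  using quad_orderI[of \<theta> 0 1] quad_conj_of_int[of 0 1] by simp_all

lemma quad_order_add:
  assumes "x \<in> quad_order \<theta>" "y \<in> quad_order \<theta>"
  shows "x + y \<in> quad_order \<theta>" "quad_conj \<theta> (x + y) = quad_conj \<theta> x + quad_conj \<theta> y"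
proof -
  obtain u v where x: "x = of_int u + of_int v * \<theta>" "quad_conj \<theta> x = of_int u + of_int v * \<kappa>"
    by (rule quad_orderE[OF assms(1)])
  obtain u' v' where y: "y = of_int u' + of_int v' * \<theta>" "quad_conj \<theta> y = of_int u' + of_int v' * \<kappa>"
    by (rule quad_orderE[OF assms(2)])
  have eq: "x + y = of_int (u + u') + of_int (v + v') * \<theta>"
    by (simp add: x y algebra_simps)
  show "x + y \<in> quad_order \<theta>"
    by (rule quad_orderI[OF eq])
  show "quad_conj \<theta> (x + y) = quad_conj \<theta> x + quad_conj \<theta> y"
    unfolding eq quad_conj_of_int x(2) y(2) by (simp add: algebra_simps)
qed

lemma quad_order_mult:
  assumes "x \<in> quad_order \<theta>" "y \<in> quad_order \<theta>"
  shows "x * y \<in> quad_order \<theta>" "quad_conj \<theta> (x * y) = quad_conj \<theta> x * quad_conj \<theta> y"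
proof -
  obtain u v where x: "x = of_int u + of_int v * \<theta>" "quad_conj \<theta> x = of_int u + of_int v * \<kappa>"
    by (rule quad_orderE[OF assms(1)])
  obtain u' v' where y: "y = of_int u' + of_int v' * \<theta>" "quad_conj \<theta> y = of_int u' + of_int v' * \<kappa>"
    by (rule quad_orderE[OF assms(2)])
  \<comment> \<open>The coefficients of the product depend only on the equation
    \<open>t * t = of_int a * t + 1\<close>, which \<theta> and \<kappa> share. Using the identity
    once for each root gives both closure under products and multiplicativity of
    conjugation.\<close>
  have ring: "(of_int u + of_int v * t) * (of_int u' + of_int v' * t)
      = of_int (u * u' + v * v') + of_int (u * v' + v * u' + v * v' * a) * t"
    if "t * t = of_int a * t + 1" for t :: real
  proof -
    have "(of_int u + of_int v * t) * (of_int u' + of_int v' * t)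
      = of_int (u * u') + of_int (u * v' + v * u') * t + of_int (v * v') * (t * t)"
      by (simp add: algebra_simps)
    then show ?thesis
      unfolding that by (simp add: algebra_simps)
  qed
  have sq: "\<kappa> * \<kappa> = of_int a * \<kappa> + 1"
    using theta_gt_1 by (subst kappa_eq) (simp add: \<kappa>_def algebra_simps)
  have eq: "x * y = of_int (u * u' + v * v') + of_int (u * v' + v * u' + v * v' * a) * \<theta>"
    unfolding x(1) y(1) using theta_square by (intro ring) (simp add: power2_eq_square)
  show "x * y \<in> quad_order \<theta>"
    by (rule quad_orderI[OF eq])
  show "quad_conj \<theta> (x * y) = quad_conj \<theta> x * quad_conj \<theta> y"
    unfolding eq quad_conj_of_int x(2) y(2) ring[OF sq] ..
qed

lemma quad_order_minus:
  assumes "x \<in> quad_order \<theta>"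
  shows "- x \<in> quad_order \<theta>" "quad_conj \<theta> (- x) = - quad_conj \<theta> x"
  using quad_order_mult[of "of_int (-1)" x] assms quad_conj_int[of "-1"]
    of_int_quad_order[of "-1"] by simp_all

lemma quad_order_diff:
  assumes "x \<in> quad_order \<theta>" "y \<in> quad_order \<theta>"
  shows "x - y \<in> quad_order \<theta>" "quad_conj \<theta> (x - y) = quad_conj \<theta> x - quad_conj \<theta> y"
  using quad_order_add[of x "- y"] quad_order_minus[of y] assms by simp_all

lemma quad_order_power:
  assumes "x \<in> quad_order \<theta>"
  shows "x ^ n \<in> quad_order \<theta> \<and> quad_conj \<theta> (x ^ n) = quad_conj \<theta> x ^ n"
  by (induction n) (simp_all add: quad_order_mult assms)

text \<open>\<theta> is a unit of the order, with inverse \<open>\<theta> - a\<close>; this is what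
  admits negative powers.\<close>

lemma inverse_theta_quad_order:
  "1 / \<theta> \<in> quad_order \<theta>" "quad_conj \<theta> (1 / \<theta>) = - \<theta>"
proof -
  have eq: "1 / \<theta> = of_int (- a) + of_int 1 * \<theta>"
    using theta_eq by simp
  show "1 / \<theta> \<in> quad_order \<theta>"
    by (rule quad_orderI[OF eq])
  show "quad_conj \<theta> (1 / \<theta>) = - \<theta>"
    unfolding eq quad_conj_of_int by (simp add: kappa_eq)
qed

lemma quad_order_powi:
  "\<theta> powi i \<in> quad_order \<theta>" "quad_conj \<theta> (\<theta> powi i) = \<kappa> powi i"
proof -
  have *: "\<theta> powi i \<in> quad_order \<theta> \<and> quad_conj \<theta> (\<theta> powi i) = \<kappa> powi i"
  proof (cases "i \<ge> 0")
    case True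
    then show ?thesis
      using quad_order_power[of \<theta> "nat i"] by (simp add: power_int_def)
  next
    case False
    moreover have "inverse \<kappa> = - \<theta>"
      by (simp add: \<kappa>_def)
    ultimately have "\<theta> powi i = (1 / \<theta>) ^ nat (- i)" "\<kappa> powi i = (- \<theta>) ^ nat (- i)"
      by (simp_all add: power_int_def inverse_eq_divide)
    then show ?thesis
      using quad_order_power[of "1 / \<theta>" "nat (- i)"] inverse_theta_quad_order by simp
  qed
  then show "\<theta> powi i \<in> quad_order \<theta>" "quad_conj \<theta> (\<theta> powi i) = \<kappa> powi i" by auto
qed

lemma quad_order_digit_sum:
  "digit_sum \<theta> m M b \<in> quad_order \<theta>"
  "quad_conj \<theta> (digit_sum \<theta> m M b) = digit_sum \<kappa> m M b"
proof -
  have "(\<Sum>i\<in>I. of_int (b i) * \<theta> powi i) \<in> quad_order \<theta> \<and>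
      quad_conj \<theta> (\<Sum>i\<in>I. of_int (b i) * \<theta> powi i) = (\<Sum>i\<in>I. of_int (b i) * \<kappa> powi i)"
    if "finite I" for I
    using that
    by induction (simp_all add: quad_order_add quad_order_mult quad_order_powi)
  then show "digit_sum \<theta> m M b \<in> quad_order \<theta>"
    "quad_conj \<theta> (digit_sum \<theta> m M b) = digit_sum \<kappa> m M b"
    by (simp_all add: digit_sum_def)
qed

section \<open>Existence of finite greedy expansions\<close>

text \<open>The beta-transformation for the base \<theta> on the interval [0, 1); the digits it
  produces are the integer parts discarded by \<open>frac\<close>.\<close>

definition greedy_step :: "real \<Rightarrow> real" where
  "greedy_step s = frac (\<theta> * s)"

lemma greedy_step_bounds [simp]: "0 \<le> greedy_step s" "greedy_step s < 1"
  by (simp_all add: greedy_step_def frac_lt_1)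

lemma quad_order_greedy_step:
  assumes "s \<in> quad_order \<theta>"
  shows "greedy_step s \<in> quad_order \<theta>"
    "quad_conj \<theta> (greedy_step s) = \<kappa> * quad_conj \<theta> s - of_int \<lfloor>\<theta> * s\<rfloor>"
  using assms by (simp_all add: greedy_step_def frac_def quad_order_diff quad_order_mult)

lemma greedy_digit_bounds:
  assumes "0 \<le> s" "s < 1"
  shows "0 \<le> \<lfloor>\<theta> * s\<rfloor>" "\<lfloor>\<theta> * s\<rfloor> \<le> a"
proof -
  show "0 \<le> \<lfloor>\<theta> * s\<rfloor>"
    using assms theta_gt_1 by simp
  have "\<theta> * s \<le> \<theta>"
    using assms theta_gt_1 by (simp add: mult_le_cancel_left1)
  then show "\<lfloor>\<theta> * s\<rfloor> \<le> a"
    using floor_mono floor_theta by metis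
qed

text \<open>The map \<open>c \<mapsto> \<kappa> c - d\<close>, \<open>0 \<le> d \<le> a\<close>, contracts towards \<open>[-\<theta>, 1]\<close>.\<close>

lemma greedy_step_conj_bounds:
  assumes "s \<in> quad_order \<theta>" "0 \<le> s" "s < 1"
    and "- \<theta> - \<epsilon> \<le> quad_conj \<theta> s" "quad_conj \<theta> s \<le> 1 + \<epsilon>"
  shows "- \<theta> - \<epsilon> / \<theta> \<le> quad_conj \<theta> (greedy_step s)"
    "quad_conj \<theta> (greedy_step s) \<le> 1 + \<epsilon> / \<theta>"
proof -
  define c where "c = quad_conj \<theta> s"
  define d where "d = \<lfloor>\<theta> * s\<rfloor>"
  have d: "0 \<le> real_of_int d" "real_of_int d \<le> real_of_int a"
    using greedy_digit_bounds[OF assms(2,3)] by (simp_all add: d_def)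
  have eq: "quad_conj \<theta> (greedy_step s) = - c / \<theta> - of_int d"
    using quad_order_greedy_step(2)[OF assms(1)] by (simp add: c_def d_def)
  have "- c / \<theta> \<le> (\<theta> + \<epsilon>) / \<theta>" "- (1 + \<epsilon>) / \<theta> \<le> - c / \<theta>"
    using assms(4,5) theta_gt_1 unfolding c_def[symmetric] by (intro divide_right_mono; linarith)+
  then have "- c / \<theta> \<le> 1 + \<epsilon> / \<theta>" "- 1 / \<theta> - \<epsilon> / \<theta> \<le> - c / \<theta>"
    using theta_gt_1 by (simp_all add: add_divide_distrib diff_divide_distrib)
  then show "- \<theta> - \<epsilon> / \<theta> \<le> quad_conj \<theta> (greedy_step s)"
    "quad_conj \<theta> (greedy_step s) \<le> 1 + \<epsilon> / \<theta>"
    unfolding eq using d theta_eq by linarith+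
qed

text \<open>The difference of \<open>s\<close> and its conjugate is
  \<open>v * (\<theta> + 1 / \<theta>)\<close> with an integer \<open>v\<close>, and the window
  leaves only \<open>v = 0\<close> and \<open>v = 1\<close>. As \<open>0 \<le> s < 1\<close>, these
  mean \<open>s = 0\<close> and \<open>s = 1 / \<theta>\<close>, and both are sent to 0.\<close>

lemma greedy_step_window:
  assumes "s \<in> quad_order \<theta>" "0 \<le> s" "s < 1"
    and "- \<theta> - 1 / \<theta> \<le> quad_conj \<theta> s" "quad_conj \<theta> s \<le> 1 + 1 / \<theta>"
  shows "greedy_step s = 0"
proof -
  obtain u v where s: "s = of_int u + of_int v * \<theta>" "quad_conj \<theta> s = of_int u + of_int v * \<kappa>"
    by (rule quad_orderE[OF assms(1)])
  have diff: "s - quad_conj \<theta> s = of_int v * (\<theta> + 1 / \<theta>)"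
    unfolding s(2) by (simp add: s(1) \<kappa>_def algebra_simps)
  have pos: "0 < 1 / \<theta>"
    using theta_gt_1 by simp
  have "- (\<theta> + 1 / \<theta>) < s - quad_conj \<theta> s"
    using assms theta_gt_1 pos by linarith
  moreover have "s - quad_conj \<theta> s < (\<theta> + 1 / \<theta>) + (\<theta> + 1 / \<theta>)"
    using assms theta_gt_1 pos by linarith
  ultimately have "(- 1) * (\<theta> + 1 / \<theta>) < of_int v * (\<theta> + 1 / \<theta>)"
    "of_int v * (\<theta> + 1 / \<theta>) < 2 * (\<theta> + 1 / \<theta>)"
    unfolding diff by simp_all
  then have "-1 < real_of_int v" "real_of_int v < 2"
    using theta_gt_1 pos by (auto simp only: mult_less_cancel_right)
  then have "v = 0 \<or> v = 1"
    by linarith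
  then show ?thesis
  proof
    assume "v = 0"
    then have "s = 0"
      using s assms(2,3) by simp
    then show ?thesis
      by (simp add: greedy_step_def)
  next
    assume v: "v = 1"
    then have "u = - a"
      using s assms(2,3) theta_bounds by simp
    then have "s = 1 / \<theta>"
      using s v theta_eq by simp
    then show ?thesis
      using theta_gt_1 by (simp add: greedy_step_def)
  qed
qed

text \<open>The distance of the conjugate from the interval [-\<theta>, 1] starts at no more than
  its absolute value \<epsilon>, and its bound is divided by \<theta> in every step. Once the bound
  is at most \<open>1 / \<theta>\<close>, the orbit is in the window from which one more step
  reaches 0.\<close>

lemma greedy_step_terminates:
  assumes "s \<in> quad_order \<theta>" "0 \<le> s" "s < 1"
  shows "\<exists>n. (greedy_step ^^ n) s = 0"
proof -
  define \<epsilon> where "\<epsilon> = \<bar>quad_conj \<theta> s\<bar>"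
  have inv: "(greedy_step ^^ n) s \<in> quad_order \<theta> \<and> 0 \<le> (greedy_step ^^ n) s \<and> (greedy_step ^^ n) s < 1
      \<and> - \<theta> - \<epsilon> / \<theta> ^ n \<le> quad_conj \<theta> ((greedy_step ^^ n) s)
      \<and> quad_conj \<theta> ((greedy_step ^^ n) s) \<le> 1 + \<epsilon> / \<theta> ^ n" for n
  proof (induction n)
    case 0
    then show ?case
      using assms theta_gt_1 by (auto simp: \<epsilon>_def)
  next
    case (Suc n)
    then have "- \<theta> - \<epsilon> / \<theta> ^ n / \<theta> \<le> quad_conj \<theta> (greedy_step ((greedy_step ^^ n) s))"
      "quad_conj \<theta> (greedy_step ((greedy_step ^^ n) s)) \<le> 1 + \<epsilon> / \<theta> ^ n / \<theta>"
      using greedy_step_conj_bounds by blast+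
    moreover have "greedy_step ((greedy_step ^^ n) s) \<in> quad_order \<theta>"
      using quad_order_greedy_step Suc by blast
    ultimately show ?case
      by (simp add: mult_ac)
  qed
  obtain n where n: "\<epsilon> * \<theta> < \<theta> ^ n"
    using real_arch_pow[OF theta_gt_1] by blast
  then have "\<epsilon> / \<theta> ^ n \<le> 1 / \<theta>"
    using theta_gt_1 by (simp add: field_simps)
  then have "greedy_step ((greedy_step ^^ n) s) = 0"
    using inv[of n] by (intro greedy_step_window) auto
  then show ?thesis
    by (intro exI[of _ "Suc n"]) simp
qed

text \<open>Induction along the orbit: \<open>s = (d + t) / \<theta>\<close>, so the digits of
  \<open>t\<close> move down by one place and \<open>d\<close> becomes the new top digit.\<close>

lemma greedy_expansion_unit_interval:
  assumes "0 \<le> s" "s < 1" "(greedy_step ^^ n) s = 0"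
  shows "\<exists>b. greedy_poly a (- int n) (-1) b \<and> s = digit_sum \<theta> (- int n) (-1) b"
  using assms
proof (induction n arbitrary: s)
  case 0
  then show ?case
    using a_pos by (intro exI[of _ "\<lambda>_. 0"]) (auto simp: greedy_poly_def)
next
  case (Suc n)
  define t where "t = greedy_step s"
  define d where "d = \<lfloor>\<theta> * s\<rfloor>"
  have t: "0 \<le> t" "t < 1" "(greedy_step ^^ n) t = 0"
    using Suc.prems by (simp_all add: t_def funpow_Suc_right del: funpow.simps(2))
  from Suc.IH[OF this] obtain b where b: "greedy_poly a (- int n) (-1) b"
    and tb: "t = digit_sum \<theta> (- int n) (-1) b"
    by blast
  have d: "0 \<le> d" "d \<le> a"
    using greedy_digit_bounds Suc.prems by (auto simp: d_def)
  have bpos: "b i \<ge> 0" for i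
    using b by (auto simp: greedy_poly_def)
  \<comment> \<open>Greediness at the junction: if \<open>d = a\<close>, then
    \<open>\<theta> * s < \<theta> = a + 1 / \<theta>\<close> leaves
    \<open>t < 1 / \<theta>\<close>, too small for a positive digit at place -1.\<close>
  have b1: "b (-1) = 0" if "d = a"
  proof (cases n)
    case 0
    then show ?thesis using b by (auto simp: greedy_poly_def)
  next
    case (Suc k)
    have "digit_sum \<theta> (- int n) (-1) b
        = digit_sum \<theta> (- int n) (-2) b + digit_sum \<theta> (-1) (-1) b"
      using digit_sum_split[of "- int n" "-2" "-1" \<theta> b] Suc by simp
    moreover have "digit_sum \<theta> (- int n) (-2) b \<ge> 0"
      using theta_gt_1 bpos by (intro digit_sum_nonneg) auto
    ultimately have "t \<ge> of_int (b (-1)) / \<theta>"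
      by (simp add: digit_sum_def tb power_int_minus divide_inverse)
    moreover have "t < 1 / \<theta>"
    proof -
      have "\<theta> * s < \<theta> * 1"
        using Suc.prems theta_gt_1 by (intro mult_strict_left_mono) auto
      then show ?thesis
        using that theta_eq by (simp add: t_def greedy_step_def frac_def d_def)
    qed
    ultimately have "of_int (b (-1)) / \<theta> < 1 / \<theta>"
      by linarith
    then show ?thesis
      using theta_gt_1 bpos[of "-1"] by (simp add: divide_less_cancel)
  qed
  define b2 where "b2 = (\<lambda>i. b (i + 1))(-1 := d)"
  have "greedy_poly a (- int (Suc n)) (-1) b2"
    unfolding greedy_poly_def
  proof (intro conjI allI impI)
    fix i
    show "b2 i \<in> {0..a}"
      using d b by (auto simp: b2_def greedy_poly_def)
    show "b2 i = 0" if "i \<notin> {- int (Suc n)..-1}"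
      using that b by (auto simp: b2_def greedy_poly_def)
    show "b2 (i - 1) = 0" if "b2 i = a"
    \<comment> \<open>At \<open>i = 0\<close> the neighbour below is the inserted digit
      \<open>d\<close>, but the premise fails there: \<open>b2 0 = b 1 = 0\<close>, while
      \<open>a\<close> is positive.\<close>
    proof (cases "i = 0")
      case True
      then show ?thesis
        using that b a_pos by (auto simp: b2_def greedy_poly_def)
    next
      case False
      have "b i = 0" if "b (i + 1) = a"
        using b that unfolding greedy_poly_def by (metis add_diff_cancel_right')
      then show ?thesis
        using that b1 False by (auto simp: b2_def split: if_splits)
    qed
  qed
  moreover have "s = digit_sum \<theta> (- int (Suc n)) (-1) b2"
  proof -
    have "digit_sum \<theta> (- int (Suc n)) (-2) b2 = digit_sum \<theta> (- int (Suc n)) (-2) (\<lambda>i. b (i - (-1)))"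
      by (rule digit_sum_cong) (auto simp: b2_def)
    also have "\<dots> = \<theta> powi (-1) * t"
      using digit_sum_shift[of \<theta> "- int n" "-1" "-1" b] theta_gt_1
      by (simp add: tb minus_diff_commute)
    finally have "digit_sum \<theta> (- int (Suc n)) (-1) b2 = \<theta> powi (-1) * t + of_int d * \<theta> powi (-1)"
      using digit_sum_split[of "- int (Suc n)" "-2" "-1" \<theta> b2]
      by (simp add: digit_sum_def b2_def)
    also have "\<dots> = s"
      using theta_gt_1
      by (simp add: t_def greedy_step_def frac_def d_def power_int_minus field_simps)
    finally show ?thesis ..
  qed
  ultimately show ?case by blast
qed

text \<open>Division by a large power of \<theta> brings \<open>x\<close> into [0, 1); the finite
  expansion found there is then shifted back.\<close>

lemma pos_greedy_poly:
  assumes "x \<in> quad_order \<theta>" "x > 0"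
  obtains m M b where "greedy_poly a m M b" "x = digit_sum \<theta> m M b"
proof -
  obtain k where k: "x < \<theta> ^ k"
    using real_arch_pow[OF theta_gt_1] by blast
  define s where "s = \<theta> powi (- int k) * x"
  have "s \<in> quad_order \<theta>"
    unfolding s_def by (intro quad_order_mult quad_order_powi assms)
  moreover have s01: "0 \<le> s" "s < 1"
    using k assms theta_gt_1 by (auto simp: s_def power_int_minus field_simps)
  ultimately obtain n where "(greedy_step ^^ n) s = 0"
    using greedy_step_terminates by blast
  from greedy_expansion_unit_interval[OF s01 this] obtain b
    where b: "greedy_poly a (- int n) (-1) b" and sb: "s = digit_sum \<theta> (- int n) (-1) b"
    by blast
  have x: "x = digit_sum \<theta> (- int n + int k) (- 1 + int k) (\<lambda>i. b (i - int k))"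
    using theta_gt_1 by (subst digit_sum_shift) (auto simp: sb[symmetric] s_def power_int_minus field_simps)
  have "b (i - int k) = a \<Longrightarrow> b (i - 1 - int k) = 0" for i
  proof -
    have "i - 1 - int k = i - int k - 1"
      by simp
    then show "b (i - int k) = a \<Longrightarrow> b (i - 1 - int k) = 0"
      using b unfolding greedy_poly_def by metis
  qed
  then have "greedy_poly a (- int n + int k) (- 1 + int k) (\<lambda>i. b (i - int k))"
    using b unfolding greedy_poly_def by auto
  from this x show thesis by (rule that)
qed

lemma pos_greedy_expansion:
  assumes "x \<in> quad_order \<theta>" "x > 0"
  obtains m M b where "greedy_poly a m M b" "b m \<noteq> 0" "x = digit_sum \<theta> m M b"
proof -
  obtain m0 M b where b: "greedy_poly a m0 M b" "x = digit_sum \<theta> m0 M b"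
    by (rule pos_greedy_poly[OF assms])
  define S where "S = {i \<in> {m0..M}. b i \<noteq> 0}"
  have fin: "finite S"
    by (rule finite_subset[of _ "{m0..M}"]) (auto simp: S_def)
  have "S \<noteq> {}"
  proof
    assume "S = {}"
    then have "digit_sum \<theta> m0 M b = 0"
      by (auto simp: digit_sum_def S_def intro!: sum.neutral)
    with b assms show False by simp
  qed
  \<comment> \<open>Discarding the zero digits at the low end makes the lowest digit
    nonzero.\<close>
  define m where "m = Min S"
  have m: "m \<in> S" "\<And>i. i < m \<Longrightarrow> i \<notin> S"
    using fin \<open>S \<noteq> {}\<close> by (auto simp: m_def)
  have below: "b i = 0" if "i < m" for i
    using m(2)[OF that] b(1) by (auto simp: S_def greedy_poly_def)
  have "greedy_poly a m M b"
    using b(1) below by (auto simp: greedy_poly_def)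
  moreover have "x = digit_sum \<theta> m M b"
    using b(2) below m(1) by (subst digit_sum_lower[symmetric, of m0]) (auto simp: S_def)
  moreover have "b m \<noteq> 0"
    using m(1) by (simp add: S_def)
  ultimately show thesis
    using that by blast
qed

lemma greedy_expansion_exists:
  assumes "x \<in> quad_order \<theta>" "x \<noteq> 0"
  shows "\<exists>m. greedy_expansion \<theta> a x m"
proof (cases "x > 0")
  case True
  show ?thesis
    by (rule pos_greedy_expansion[OF assms(1) True]) (auto simp: greedy_expansion_def)
next
  case False
  then have "- x > 0"
    using assms(2) by simp
  with quad_order_minus(1)[OF assms(1)]
  obtain m M b where "greedy_poly a m M b" "b m \<noteq> 0" "- x = digit_sum \<theta> m M b"
    by (rule pos_greedy_expansion)
  then have "greedy_expansion \<theta> a x m"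
    unfolding greedy_expansion_def by (metis minus_minus)
  then show ?thesis ..
qed

section \<open>The absolute value and the conjugate\<close>

text \<open>A Horner step: once the power of \<kappa> is factored out, prepending a lower digit
  turns the normalised sum \<open>T\<close> into \<open>b m - T / \<theta>\<close>.\<close>

lemma digit_sum_kappa_rec:
  assumes "m \<le> M" "digit_sum \<kappa> (m + 1) M b = \<kappa> powi (m + 1) * T"
  shows "digit_sum \<kappa> m M b = \<kappa> powi m * (of_int (b m) - T / \<theta>)"
proof -
  have "digit_sum \<kappa> m M b = of_int (b m) * \<kappa> powi m + \<kappa> powi (m + 1) * T"
    unfolding digit_sum_rec[OF assms(1)] assms(2) ..
  then show ?thesis
    by (simp add: power_int_add algebra_simps)
qed

text \<open>Because \<open>\<theta> = a + 1 / \<theta>\<close>, each map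
  \<open>T \<mapsto> d - T / \<theta>\<close> with \<open>0 \<le> d \<le> a\<close> sends the open
  interval from -1 to \<theta> into itself; the empty sum starts at \<open>T = 0\<close>.\<close>

lemma digit_sum_kappa_bounds:
  assumes "\<And>i. b i \<in> {0..a}"
  shows "\<exists>T. digit_sum \<kappa> m M b = \<kappa> powi m * T \<and> - 1 < T \<and> T < \<theta>"
proof (induction "nat (M - m + 1)" arbitrary: m)
  case 0
  then show ?case
    using theta_gt_1 by (intro exI[of _ 0]) auto
next
  case (Suc n)
  have "n = nat (M - (m + 1) + 1)"
    using Suc(2) by simp
  from Suc(1)[OF this]
  obtain T where T: "digit_sum \<kappa> (m + 1) M b = \<kappa> powi (m + 1) * T" "- 1 < T" "T < \<theta>"
    by blast
  have "digit_sum \<kappa> m M b = \<kappa> powi m * (of_int (b m) - T / \<theta>)"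
    using Suc(2) T(1) by (intro digit_sum_kappa_rec) auto
  moreover have "T / \<theta> < 1" "- 1 / \<theta> < T / \<theta>"
    using T theta_gt_1 by (auto simp: field_simps)
  moreover have "0 \<le> real_of_int (b m)" "real_of_int (b m) \<le> real_of_int a"
    using assms[of m] by auto
  ultimately show ?case
    using theta_eq by (intro exI[of _ "of_int (b m) - T / \<theta>"]) auto
qed

lemma digit_sum_kappa_abs_le:
  assumes "\<And>i. b i \<in> {0..a}"
  shows "\<bar>digit_sum \<kappa> m M b\<bar> \<le> \<theta> * \<theta> powi (- m)"
proof -
  obtain T where T: "digit_sum \<kappa> m M b = \<kappa> powi m * T" "- 1 < T" "T < \<theta>"
    using digit_sum_kappa_bounds[where b = b and m = m and M = M, OF assms] by blast
  have "\<bar>T\<bar> \<le> \<theta>"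
    using T theta_gt_1 by auto
  then show ?thesis
    using theta_gt_1 by (simp add: T(1) abs_mult abs_kappa_powi mult.commute)
qed

text \<open>
  A nonzero lowest digit \<open>b m\<close> forces \<open>b (m + 1) < a\<close>, which keeps the alternating sum away from
  zero.
\<close>

lemma greedy_expansion_conj_bounds:
  assumes "greedy_expansion \<theta> a x m"
  shows "x \<in> quad_order \<theta>" "\<theta> powi (- m) / \<theta> < \<bar>quad_conj \<theta> x\<bar>" "\<bar>quad_conj \<theta> x\<bar> < \<theta> powi (- m) * \<theta>"
    "(even m \<longleftrightarrow> quad_conj \<theta> x > 0) \<longleftrightarrow> x > 0"
proof -
  obtain M b where b: "greedy_poly a m M b" "b m \<noteq> 0"
    and x: "x = digit_sum \<theta> m M b \<or> x = - digit_sum \<theta> m M b"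
    using assms by (auto simp: greedy_expansion_def)
  have dig: "b i \<in> {0..a}" for i
    using b by (auto simp: greedy_poly_def)
  have "m \<le> M"
    using b by (force simp: greedy_poly_def)
  \<comment> \<open>Since the digit at \<open>m + 1\<close> is at most \<open>a - 1\<close>, the
    upper end of the interval drops from \<theta> to \<open>\<theta> - 1\<close>. If there is no
    such place, the sum is empty and \<open>T = 0\<close> serves.\<close>
  obtain T where T: "digit_sum \<kappa> (m + 1) M b = \<kappa> powi (m + 1) * T" "- 1 < T" "T < \<theta> - 1"
  proof (cases "m + 1 \<le> M")
    case False
    have "\<theta> > 1" by (rule theta_gt_1)
    then show thesis
      using False by (intro that[of 0]) auto
  next
    case True
    obtain T where T: "digit_sum \<kappa> (m + 1 + 1) M b = \<kappa> powi (m + 1 + 1) * T" "- 1 < T" "T < \<theta>"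
      using digit_sum_kappa_bounds[where b = b and m = "m + 1 + 1" and M = M, OF dig] by blast
    have "b (m + 1) \<noteq> a"
      using b by (force simp: greedy_poly_def)
    then have le: "0 \<le> real_of_int (b (m + 1))" "real_of_int (b (m + 1)) \<le> real_of_int a - 1"
      using dig[of "m + 1"] by auto
    have "digit_sum \<kappa> (m + 1) M b = \<kappa> powi (m + 1) * (of_int (b (m + 1)) - T / \<theta>)"
      by (rule digit_sum_kappa_rec[OF True T(1)])
    moreover have "T / \<theta> < 1" "- 1 / \<theta> < T / \<theta>"
      using T theta_gt_1 by (auto simp: field_simps)
    ultimately show thesis
      using theta_eq le by (intro that[of "of_int (b (m + 1)) - T / \<theta>"]) auto
  qed
  \<comment> \<open>The normalised sum of the whole expansion. The improved bound
    \<open>T < \<theta> - 1\<close> together with \<open>b m \<ge> 1\<close> is exactly what gives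
    \<open>U > 1 / \<theta>\<close>.\<close>
  define U where "U = of_int (b m) - T / \<theta>"
  have DU: "digit_sum \<kappa> m M b = \<kappa> powi m * U"
    unfolding U_def by (rule digit_sum_kappa_rec[OF \<open>m \<le> M\<close> T(1)])
  have "T / \<theta> < 1 - 1 / \<theta>" "- 1 / \<theta> < T / \<theta>"
    using T theta_gt_1 by (auto simp: field_simps)
  moreover have "1 \<le> real_of_int (b m)" "real_of_int (b m) \<le> real_of_int a"
    using dig[of m] b(2) by auto
  ultimately have U: "1 / \<theta> < U" "U < \<theta>"
    using theta_eq unfolding U_def by linarith+
  have Upos: "U > 0"
    using U(1) theta_gt_1 by (intro less_trans[OF _ U(1)]) simp
  have cx: "quad_conj \<theta> x = \<kappa> powi m * U \<and> x = digit_sum \<theta> m M b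
      \<or> quad_conj \<theta> x = - (\<kappa> powi m * U) \<and> x = - digit_sum \<theta> m M b"
    using x DU by (auto simp: quad_order_digit_sum quad_order_minus)
  show "x \<in> quad_order \<theta>"
    using x by (auto simp: quad_order_digit_sum quad_order_minus)
  have ab: "\<bar>quad_conj \<theta> x\<bar> = \<theta> powi (- m) * U"
    using cx Upos by (auto simp: abs_mult abs_kappa_powi)
  have p: "\<theta> powi (- m) > 0"
    using theta_gt_1 by simp
  show "\<theta> powi (- m) / \<theta> < \<bar>quad_conj \<theta> x\<bar>" "\<bar>quad_conj \<theta> x\<bar> < \<theta> powi (- m) * \<theta>"
    unfolding ab using mult_strict_left_mono[OF U(1) p] mult_strict_left_mono[OF U(2) p] by auto
  have "digit_sum \<theta> m M b \<ge> 0"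
    using theta_gt_1 dig by (intro digit_sum_nonneg) auto
  moreover have "x \<noteq> 0"
    using ab p Upos by auto
  ultimately have xs: "x > 0 \<longleftrightarrow> x = digit_sum \<theta> m M b"
    using x by auto
  have ks: "\<kappa> powi m > 0 \<longleftrightarrow> even m" "\<kappa> powi m \<noteq> 0"
  proof -
    have "\<kappa> powi m = (if even m then (1 / \<theta>) powi m else - ((1 / \<theta>) powi m))"
      using power_int_minus_left[of "1 / \<theta>" m] by (simp add: \<kappa>_def)
    moreover have "(1 / \<theta>) powi m > 0"
      using theta_gt_1 by simp
    ultimately show "\<kappa> powi m > 0 \<longleftrightarrow> even m"
      by (metis less_asym neg_less_0_iff_less)
    show "\<kappa> powi m \<noteq> 0"
      by simp
  qed
  show "(even m \<longleftrightarrow> quad_conj \<theta> x > 0) \<longleftrightarrow> x > 0"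
  proof (cases "x > 0")
    case True
    then have "quad_conj \<theta> x = \<kappa> powi m * U"
      using cx xs \<open>x \<noteq> 0\<close> by auto
    then show ?thesis
      using True ks Upos by (simp add: zero_less_mult_iff)
  next
    case False
    then have "quad_conj \<theta> x = - (\<kappa> powi m * U)"
      using cx xs by auto
    moreover have "\<kappa> powi m < 0 \<longleftrightarrow> \<not> even m"
      using ks by linarith
    then have "- (\<kappa> powi m * U) > 0 \<longleftrightarrow> \<not> even m"
      using Upos by (auto simp: mult_less_0_iff)
    ultimately show ?thesis
      using False by simp
  qed
qed

text \<open>The signs of \<open>x\<close> and of its conjugate determine the parity of the exponent,
  so distinct exponents differ by at least 2. The strict size bounds span only a factor
  \<open>\<theta>\<^sup>2\<close>, hence the ranges for such exponents are disjoint.\<close>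

lemma greedy_expansion_unique:
  assumes "greedy_expansion \<theta> a x m" "greedy_expansion \<theta> a x n"
  shows "m = n"
proof -
  have no_less: "\<not> m < n" if mn: "greedy_expansion \<theta> a x m" "greedy_expansion \<theta> a x n" for m n
  proof
    assume "m < n"
    have "even m \<longleftrightarrow> even n"
      using greedy_expansion_conj_bounds(4)[OF mn(1)] greedy_expansion_conj_bounds(4)[OF mn(2)]
      by argo
    with \<open>m < n\<close> have "m + 2 \<le> n"
      by presburger
    then have "\<theta> powi (- n) \<le> \<theta> powi (- m + - 2)"
      using theta_gt_1 by (intro power_int_increasing) auto
    also have "\<dots> = \<theta> powi (- m) / \<theta> ^ 2"
      using theta_gt_1 by (subst power_int_add) (auto simp: power_int_minus divide_inverse)
    finally have "\<theta> powi (- n) * \<theta> \<le> \<theta> powi (- m) / \<theta>"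
      using theta_gt_1 by (simp add: field_simps power2_eq_square)
    then show False
      using greedy_expansion_conj_bounds(2)[OF mn(1)] greedy_expansion_conj_bounds(3)[OF mn(2)]
      by linarith
  qed
  show ?thesis
    using no_less[OF assms] no_less[OF assms(2,1)] by linarith
qed

lemma theta_abs_eq:
  assumes "greedy_expansion \<theta> a x m"
  shows "theta_abs \<theta> a x = \<theta> powi (- m)"
proof -
  have "0 < \<theta> powi (- m) / \<theta>"
    using theta_gt_1 by simp
  then have "x \<noteq> 0"
    using greedy_expansion_conj_bounds(2)[OF assms] by auto
  moreover have "(THE r. \<exists>m. greedy_expansion \<theta> a x m \<and> r = \<theta> powi (- m)) = \<theta> powi (- m)"
    using assms greedy_expansion_unique by (intro the_equality) blast+
  ultimately show ?thesis
    by (simp add: theta_abs_def)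
qed

text \<open>For a nonzero number both quantities are governed by the exponent \<open>m\<close> of
  its expansion and agree up to a factor \<theta>. Cauchy and null sequences can therefore be
  recognised on conjugates.\<close>

lemma theta_abs_conj:
  assumes "x \<in> quad_order \<theta>"
  shows "0 \<le> theta_abs \<theta> a x" "theta_abs \<theta> a x \<le> \<theta> * \<bar>quad_conj \<theta> x\<bar>"
    "\<bar>quad_conj \<theta> x\<bar> \<le> \<theta> * theta_abs \<theta> a x"
proof -
  have "0 \<le> theta_abs \<theta> a x \<and> theta_abs \<theta> a x \<le> \<theta> * \<bar>quad_conj \<theta> x\<bar>
    \<and> \<bar>quad_conj \<theta> x\<bar> \<le> \<theta> * theta_abs \<theta> a x"
  proof (cases "x = 0")
    case True
    then show ?thesis
      by (simp add: theta_abs_def)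
  next
    case False
    then obtain m where m: "greedy_expansion \<theta> a x m"
      using greedy_expansion_exists assms by blast
    show ?thesis
      using greedy_expansion_conj_bounds(2,3)[OF m] theta_gt_1
      by (simp add: theta_abs_eq[OF m] field_simps)
  qed
  then show "0 \<le> theta_abs \<theta> a x" "theta_abs \<theta> a x \<le> \<theta> * \<bar>quad_conj \<theta> x\<bar>"
    "\<bar>quad_conj \<theta> x\<bar> \<le> \<theta> * theta_abs \<theta> a x" by auto
qed

section \<open>The completion is the real line\<close>

text \<open>These sets turn out to be the cosets of the null ideal, one for each real
  \<open>r\<close>.\<close>

definition conj_class :: "real \<Rightarrow> (nat \<Rightarrow> real) set" where
  "conj_class r = {f. (\<forall>n. f n \<in> quad_order \<theta>) \<and> (\<lambda>n. quad_conj \<theta> (f n)) \<longlonglongrightarrow> r}"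

lemma conj_class_add:
  "f \<in> conj_class r \<Longrightarrow> g \<in> conj_class s \<Longrightarrow> (\<lambda>n. f n + g n) \<in> conj_class (r + s)"
  by (auto simp: conj_class_def quad_order_add intro!: tendsto_add)

lemma conj_class_diff:
  "f \<in> conj_class r \<Longrightarrow> g \<in> conj_class s \<Longrightarrow> (\<lambda>n. f n - g n) \<in> conj_class (r - s)"
  by (auto simp: conj_class_def quad_order_diff intro!: tendsto_diff)

lemma conj_class_mult:
  "f \<in> conj_class r \<Longrightarrow> g \<in> conj_class s \<Longrightarrow> (\<lambda>n. f n * g n) \<in> conj_class (r * s)"
  by (auto simp: conj_class_def quad_order_mult intro!: tendsto_mult)

lemma conj_class_subseq:
  "f \<in> conj_class r \<Longrightarrow> strict_mono \<phi> \<Longrightarrow> f \<circ> \<phi> \<in> conj_class r"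
  using LIMSEQ_subseq_LIMSEQ[of "\<lambda>n. quad_conj \<theta> (f n)" r \<phi>]
  by (auto simp: conj_class_def comp_def)

lemma conj_class_unique:
  "f \<in> conj_class r \<Longrightarrow> f \<in> conj_class s \<Longrightarrow> r = s"
  using LIMSEQ_unique by (auto simp: conj_class_def)

text \<open>Density of the conjugates: rounding \<open>r\<close> down to a multiple of
  \<open>\<kappa> ^ n\<close>, in units of that number, leaves an error of at most
  \<open>\<bar>\<kappa>\<bar> ^ n\<close>, and every such multiple is the conjugate of a multiple of
  \<open>\<theta> ^ n\<close>.\<close>

lemma conj_class_nonempty: "conj_class r \<noteq> {}"
proof -
  define f where "f n = of_int \<lfloor>r / \<kappa> ^ n\<rfloor> * \<theta> ^ n" for n
  have f: "f n \<in> quad_order \<theta>" "quad_conj \<theta> (f n) = of_int \<lfloor>r / \<kappa> ^ n\<rfloor> * \<kappa> ^ n" for n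
    using quad_order_power[of \<theta> n] by (simp_all add: f_def quad_order_mult)
  have "\<bar>\<kappa>\<bar> < 1"
    using theta_gt_1 by (simp add: \<kappa>_def)
  then have lim: "(\<lambda>n. \<kappa> ^ n) \<longlonglongrightarrow> 0"
    by (intro LIMSEQ_power_zero) simp
  have "norm (quad_conj \<theta> (f n) - r) \<le> norm (\<kappa> ^ n) * 1" for n
  proof -
    have "quad_conj \<theta> (f n) - r = \<kappa> ^ n * - frac (r / \<kappa> ^ n)"
      by (simp add: f frac_def algebra_simps)
    moreover have "\<bar>frac (r / \<kappa> ^ n)\<bar> \<le> 1"
      using frac_lt_1[of "r / \<kappa> ^ n"] by simp
    ultimately show ?thesis
      by (simp add: norm_mult abs_mult mult_left_le del: frac_eq)
  qed
  then have "(\<lambda>n. quad_conj \<theta> (f n) - r) \<longlonglongrightarrow> 0"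
    by (intro tendsto_0_le[OF lim] always_eventually allI)
  then have "f \<in> conj_class r"
    using f by (simp add: conj_class_def LIM_zero_iff)
  then show ?thesis by blast
qed

text \<open>Comparability turns the condition into ordinary Cauchy convergence of the conjugates,
  and the reals are complete.\<close>

lemma theta_Cauchy_iff:
  "theta_Cauchy (quad_order \<theta>) \<theta> a f \<longleftrightarrow> (\<exists>r. f \<in> conj_class r)"
proof -
  \<comment> \<open>The passage from \<epsilon> to \<open>\<epsilon> / \<theta>\<close>, stated for
    two arbitrary distances because it is applied in both directions.\<close>
  have scale: "(\<forall>\<epsilon>>0. \<exists>N. \<forall>m\<ge>N. \<forall>n\<ge>N. d' m n < \<epsilon>)"
    if "\<forall>\<epsilon>>0. \<exists>N. \<forall>m\<ge>N. \<forall>n\<ge>N. d m n < \<epsilon>" "\<And>m n. d' m n \<le> \<theta> * d m n"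
    for d d' :: "nat \<Rightarrow> nat \<Rightarrow> real"
  proof (intro allI impI)
    fix \<epsilon> :: real
    assume "\<epsilon> > 0"
    then have "\<epsilon> / \<theta> > 0"
      using theta_gt_1 by simp
    with that(1) obtain N where N: "\<forall>m\<ge>N. \<forall>n\<ge>N. d m n < \<epsilon> / \<theta>"
      by blast
    have "d' m n < \<epsilon>" if "m \<ge> N" "n \<ge> N" for m n
    proof -
      have "\<theta> * d m n < \<epsilon>"
        using N that theta_gt_1 by (simp add: field_simps)
      then show ?thesis
        using \<open>\<And>m n. d' m n \<le> \<theta> * d m n\<close>[of m n] by linarith
    qed
    then show "\<exists>N. \<forall>m\<ge>N. \<forall>n\<ge>N. d' m n < \<epsilon>" by blast
  qed
  have "theta_Cauchy (quad_order \<theta>) \<theta> a f \<longleftrightarrow>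
      (\<forall>n. f n \<in> quad_order \<theta>) \<and> Cauchy (\<lambda>n. quad_conj \<theta> (f n))"
  proof (cases "\<forall>n. f n \<in> quad_order \<theta>")
    case True
    have le: "theta_abs \<theta> a (f m - f n) \<le> \<theta> * \<bar>quad_conj \<theta> (f m) - quad_conj \<theta> (f n)\<bar>"
      "\<bar>quad_conj \<theta> (f m) - quad_conj \<theta> (f n)\<bar> \<le> \<theta> * theta_abs \<theta> a (f m - f n)" for m n
      using theta_abs_conj[of "f m - f n"] True by (simp_all add: quad_order_diff)
    let ?d = "\<lambda>m n. theta_abs \<theta> a (f m - f n)"
    let ?d' = "\<lambda>m n. \<bar>quad_conj \<theta> (f m) - quad_conj \<theta> (f n)\<bar>"
    show ?thesis
      unfolding theta_Cauchy_def Cauchy_def dist_real_def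
      using scale[of ?d ?d', OF _ le(2)] scale[of ?d' ?d, OF _ le(1)] by blast
  qed (auto simp: theta_Cauchy_def)
  then show ?thesis
    by (auto simp: conj_class_def Cauchy_convergent_iff convergent_def)
qed

lemma carrier_cauchy_ring:
  "carrier (cauchy_ring (quad_order \<theta>) \<theta> a) = (\<Union>r. conj_class r)"
  by (auto simp: cauchy_ring_def theta_Cauchy_iff)

lemma null_ideal_eq: "null_ideal (quad_order \<theta>) \<theta> a = conj_class 0"
proof (intro equalityI subsetI)
  fix f
  assume "f \<in> null_ideal (quad_order \<theta>) \<theta> a"
  then have f: "\<forall>n. f n \<in> quad_order \<theta>" and lim: "(\<lambda>n. theta_abs \<theta> a (f n)) \<longlonglongrightarrow> 0"
    by (auto simp: null_ideal_def carrier_cauchy_ring conj_class_def)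
  have "(\<lambda>n. quad_conj \<theta> (f n)) \<longlonglongrightarrow> 0"
    by (rule tendsto_0_le[OF lim, of _ \<theta>])
      (use f theta_abs_conj in \<open>auto simp: mult.commute\<close>)
  with f show "f \<in> conj_class 0"
    by (simp add: conj_class_def)
next
  fix f
  assume f: "f \<in> conj_class 0"
  then have mem: "\<forall>n. f n \<in> quad_order \<theta>" and lim: "(\<lambda>n. quad_conj \<theta> (f n)) \<longlonglongrightarrow> 0"
    by (auto simp: conj_class_def)
  have "(\<lambda>n. theta_abs \<theta> a (f n)) \<longlonglongrightarrow> 0"
    by (rule tendsto_0_le[OF lim, of _ \<theta>])
      (use mem theta_abs_conj in \<open>auto simp: mult.commute\<close>)
  with f show "f \<in> null_ideal (quad_order \<theta>) \<theta> a"
    by (auto simp: null_ideal_def carrier_cauchy_ring)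
qed

text \<open>Addition in the quotient is the elementwise sum of cosets, so equality of sets is
  required. For the harder inclusion, any fixed \<open>f\<close> in the first class splits
  \<open>h\<close> as \<open>f + (h - f)\<close>.\<close>

lemma conj_class_sumset:
  "(\<Union>f\<in>conj_class r. \<Union>g\<in>conj_class s. {\<lambda>n. f n + g n}) = conj_class (r + s)"
proof (intro equalityI subsetI)
  fix h
  assume h: "h \<in> conj_class (r + s)"
  obtain f where f: "f \<in> conj_class r"
    using conj_class_nonempty by blast
  have "(\<lambda>n. h n - f n) \<in> conj_class s"
    using conj_class_diff[OF h f] by simp
  moreover have "h = (\<lambda>n. f n + (h n - f n))"
    by simp
  ultimately show "h \<in> (\<Union>f\<in>conj_class r. \<Union>g\<in>conj_class s. {\<lambda>n. f n + g n})"
    using f by blast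
qed (auto intro: conj_class_add)

text \<open>Two sequences of the order with the same limit of conjugates differ by a null sequence,
  and adding a null sequence keeps the limit.\<close>

lemma null_ideal_coset:
  assumes "f \<in> conj_class r"
  shows "null_ideal (quad_order \<theta>) \<theta> a +>\<^bsub>cauchy_ring (quad_order \<theta>) \<theta> a\<^esub> f = conj_class r"
proof (intro equalityI subsetI)
  fix h
  assume "h \<in> null_ideal (quad_order \<theta>) \<theta> a +>\<^bsub>cauchy_ring (quad_order \<theta>) \<theta> a\<^esub> f"
  then obtain g where "g \<in> conj_class 0" "h = (\<lambda>n. g n + f n)"
    by (auto simp: a_r_coset_def' null_ideal_eq cauchy_ring_def)
  then show "h \<in> conj_class r"
    using conj_class_add[of g 0 f r] assms by simp
next
  fix h
  assume "h \<in> conj_class r"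
  then have "(\<lambda>n. h n - f n) \<in> conj_class 0"
    using conj_class_diff[of h r f r] assms by simp
  then show "h \<in> null_ideal (quad_order \<theta>) \<theta> a +>\<^bsub>cauchy_ring (quad_order \<theta>) \<theta> a\<^esub> f"
    by (auto simp: a_r_coset_def' null_ideal_eq cauchy_ring_def intro!: bexI[of _ "\<lambda>n. h n - f n"])
qed

lemma carrier_completion: "carrier (completion (quad_order \<theta>) \<theta> a) = range conj_class"
proof -
  have "carrier (completion (quad_order \<theta>) \<theta> a) =
      (\<Union>r. \<Union>f\<in>conj_class r.
        {null_ideal (quad_order \<theta>) \<theta> a +>\<^bsub>cauchy_ring (quad_order \<theta>) \<theta> a\<^esub> f})"
    by (auto simp: completion_def FactRing_def A_RCOSETS_def' carrier_cauchy_ring)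
  also have "\<dots> = (\<Union>r. \<Union>f\<in>conj_class r. {conj_class r})"
    by (simp add: null_ideal_coset)
  also have "\<dots> = range conj_class"
    using conj_class_nonempty by auto
  finally show ?thesis .
qed

lemma completion_add:
  "conj_class r \<oplus>\<^bsub>completion (quad_order \<theta>) \<theta> a\<^esub> conj_class s = conj_class (r + s)"
  unfolding completion_def FactRing_def
  by (simp add: set_add_def' conj_class_sumset[symmetric] cauchy_ring_def)

lemma completion_mult:
  "conj_class r \<otimes>\<^bsub>completion (quad_order \<theta>) \<theta> a\<^esub> conj_class s = conj_class (r * s)"
proof -
  have "conj_class r \<otimes>\<^bsub>completion (quad_order \<theta>) \<theta> a\<^esub> conj_class s =
      (\<Union>f\<in>conj_class r. \<Union>g\<in>conj_class s. null_ideal (quad_order \<theta>) \<theta> a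
        +>\<^bsub>cauchy_ring (quad_order \<theta>) \<theta> a\<^esub> (\<lambda>n. f n * g n))"
    unfolding completion_def FactRing_def by (simp add: rcoset_mult_def cauchy_ring_def)
  \<comment> \<open>Multiplication in the quotient is a union of cosets over all representatives.
    They all coincide, and the union is nonempty because the classes are.\<close>
  also have "\<dots> = (\<Union>f\<in>conj_class r. \<Union>g\<in>conj_class s. conj_class (r * s))"
    by (simp add: null_ideal_coset[OF conj_class_mult])
  also have "\<dots> = conj_class (r * s)"
    using conj_class_nonempty by auto
  finally show ?thesis .
qed

lemma completion_conj_eq: "completion_conj \<theta> (conj_class r) = r"
  unfolding completion_conj_def
proof (rule the_equality)
  show "\<forall>f\<in>conj_class r. (\<lambda>n. quad_conj \<theta> (f n)) \<longlonglongrightarrow> r"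
    by (simp add: conj_class_def)
next
  fix s
  assume s: "\<forall>f\<in>conj_class r. (\<lambda>n. quad_conj \<theta> (f n)) \<longlonglongrightarrow> s"
  obtain f where "f \<in> conj_class r"
    using conj_class_nonempty by blast
  with s show "s = r"
    using LIMSEQ_unique by (auto simp: conj_class_def)
qed

section \<open>Values of theta-adic numbers\<close>

text \<open>The Laurent series evaluated at \<kappa>, indexed by naturals from its lowest term
  upwards; this is the explicit form of \<open>x'\<close>.\<close>

definition conj_value :: "int fls \<Rightarrow> real" where
  "conj_value x =
     (\<Sum>j. of_int (fls_nth x (fls_subdegree x + int j)) * \<kappa> powi (fls_subdegree x + int j))"

text \<open>Comparison with a geometric series of ratio \<open>1 / \<theta>\<close>. Bounding
  absolute values of digits treats greedy series and their negatives alike.\<close>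

lemma conj_value_sums:
  assumes "\<And>i. \<bar>fls_nth x i\<bar> \<le> a"
  shows "(\<lambda>j. of_int (fls_nth x (fls_subdegree x + int j)) * \<kappa> powi (fls_subdegree x + int j))
    sums conj_value x"
proof -
  define s where "s = fls_subdegree x"
  have "norm (of_int (fls_nth x (s + int j)) * \<kappa> powi (s + int j))
      \<le> of_int a * \<theta> powi (- s) * (1 / \<theta>) ^ j" for j
  proof -
    have "\<bar>\<kappa> powi (s + int j)\<bar> = \<theta> powi (- s) * (1 / \<theta>) ^ j"
      unfolding abs_kappa_powi using theta_gt_1
      by (simp add: power_int_add power_int_minus power_int_diff divide_inverse power_inverse)
    moreover have "\<bar>real_of_int (fls_nth x (s + int j))\<bar> \<le> of_int a"
      using assms[of "s + int j"] by linarith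
    ultimately show ?thesis
      using theta_gt_1 by (simp add: abs_mult mult.assoc mult_right_mono)
  qed
  moreover have "summable (\<lambda>j. of_int a * \<theta> powi (- s) * (1 / \<theta>) ^ j)"
    using theta_gt_1 by (intro summable_mult summable_geometric) simp
  ultimately have "summable (\<lambda>j. of_int (fls_nth x (s + int j)) * \<kappa> powi (s + int j))"
    by (rule summable_comparison_test'[of _ 0, rotated])
  then show ?thesis
    by (simp add: conj_value_def s_def summable_sums)
qed

lemma conj_value_uminus:
  assumes "\<And>i. \<bar>fls_nth x i\<bar> \<le> a"
  shows "conj_value (- x) = - conj_value x"
  using sums_minus[OF conj_value_sums[OF assms]]
  by (simp add: conj_value_def sums_iff)

lemma digit_sum_kappa_tendsto:
  assumes "\<And>i. \<bar>fls_nth x i\<bar> \<le> a" "filterlim M at_top sequentially"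
  shows "(\<lambda>n. digit_sum \<kappa> (fls_subdegree x) (M n) (fls_nth x)) \<longlonglongrightarrow> conj_value x"
proof -
  define s where "s = fls_subdegree x"
  define t where "t j = of_int (fls_nth x (s + int j)) * \<kappa> powi (s + int j)" for j
  \<comment> \<open>Cutting at degree \<open>N\<close> keeps \<open>N - s + 1\<close> terms;
    \<open>nat\<close> yields the empty sum when the cut lies below the series.\<close>
  have "digit_sum \<kappa> s N (fls_nth x) = sum t {..<nat (N - s + 1)}" for N
    unfolding digit_sum_def t_def
    by (rule sum.reindex_bij_witness[of _ "\<lambda>j. s + int j" "\<lambda>i. nat (i - s)"]) auto
  moreover have "(\<lambda>n. sum t {..<n}) \<longlonglongrightarrow> conj_value x"
    using conj_value_sums[OF assms(1)] by (simp add: t_def s_def sums_def)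
  moreover have "filterlim (\<lambda>n. nat (M n - s + 1)) at_top sequentially"
    unfolding filterlim_at_top
  proof
    fix Z
    have "eventually (\<lambda>n. int Z + s \<le> M n) sequentially"
      using assms(2) by (auto simp: filterlim_at_top)
    then show "eventually (\<lambda>n. Z \<le> nat (M n - s + 1)) sequentially"
      by eventually_elim linarith
  qed
  ultimately show ?thesis
    by (auto simp: s_def[symmetric] intro: filterlim_compose)
qed

text \<open>The correction above the cut starts at \<open>M n + 1\<close>, so its conjugate is at
  most \<open>\<theta> powi (- M n)\<close> in absolute value and vanishes in the limit. Only the
  truncations of the series contribute.\<close>

lemma greedy_partial_sums_conj_class:
  assumes "x \<in> greedy_laurent a" "greedy_partial_sums \<theta> a x f"
  shows "f \<in> conj_class (conj_value x)"
proof -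
  obtain M where M: "filterlim M at_top sequentially"
    and ex: "\<And>n. \<exists>N d. greedy_poly a (M n + 1) N d \<and>
           f n = digit_sum \<theta> (fls_subdegree x) (M n) (fls_nth x) + digit_sum \<theta> (M n + 1) N d"
    using assms(2) unfolding greedy_partial_sums_def by blast
  obtain N d where d: "\<And>n. greedy_poly a (M n + 1) (N n) (d n)"
    and f: "\<And>n. f n = digit_sum \<theta> (fls_subdegree x) (M n) (fls_nth x)
                    + digit_sum \<theta> (M n + 1) (N n) (d n)"
    using ex by metis
  define r where "r n = digit_sum \<kappa> (M n + 1) (N n) (d n)" for n
  have "\<bar>r n\<bar> \<le> \<theta> * \<theta> powi (- (M n + 1))" for n
    unfolding r_def using d[of n] by (intro digit_sum_kappa_abs_le) (auto simp: greedy_poly_def)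
  then have r_le: "\<bar>r n\<bar> \<le> \<theta> powi (- M n)" for n
    using theta_gt_1 power_int_add_1'[of \<theta> "- (M n + 1)"] by simp
  have lim: "(\<lambda>n. \<theta> powi (- M n)) \<longlonglongrightarrow> 0"
  proof (rule LIMSEQ_I)
    fix e :: real
    assume "e > 0"
    obtain k where k: "1 / e < \<theta> ^ k"
      using real_arch_pow[OF theta_gt_1] by blast
    have "eventually (\<lambda>n. int k \<le> M n) sequentially"
      using M by (auto simp: filterlim_at_top)
    then obtain n0 where n0: "\<And>n. n \<ge> n0 \<Longrightarrow> int k \<le> M n"
      by (auto simp: eventually_sequentially)
    have "norm (\<theta> powi (- M n) - 0) < e" if "n \<ge> n0" for n
    proof -
      have "\<theta> powi (- M n) \<le> \<theta> powi (- int k)"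
        using n0[OF that] theta_gt_1 by (intro power_int_increasing) auto
      also have "\<dots> < e"
        using k \<open>e > 0\<close> theta_gt_1 by (simp add: power_int_minus field_simps)
      finally show ?thesis
        using theta_gt_1 by simp
    qed
    then show "\<exists>n0. \<forall>n\<ge>n0. norm (\<theta> powi (- M n) - 0) < e"
      by blast
  qed
  have "r \<longlonglongrightarrow> 0"
    using r_le theta_gt_1
    by (intro tendsto_0_le[OF lim, of r 1] always_eventually allI) simp_all
  moreover have "\<bar>fls_nth x i\<bar> \<le> a" for i
    using assms(1) a_pos theta_adic_digit_bound[of a x] by (auto simp: theta_adic_def)
  then have "(\<lambda>n. digit_sum \<kappa> (fls_subdegree x) (M n) (fls_nth x)) \<longlonglongrightarrow> conj_value x"
    using M by (rule digit_sum_kappa_tendsto)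
  ultimately have "(\<lambda>n. digit_sum \<kappa> (fls_subdegree x) (M n) (fls_nth x) + r n) \<longlonglongrightarrow> conj_value x + 0"
    by (intro tendsto_add)
  then show ?thesis
    unfolding conj_class_def by (simp add: f r_def quad_order_digit_sum quad_order_add)
qed

lemma partial_sums_conj_class:
  assumes "partial_sums (quad_order \<theta>) \<theta> a x f"
  shows "f \<in> conj_class (conj_value x)"
proof -
  consider "x \<in> greedy_laurent a" "greedy_partial_sums \<theta> a x f"
    | "- x \<in> greedy_laurent a" "greedy_partial_sums \<theta> a (- x) (\<lambda>n. - f n)"
    using assms by (auto simp: partial_sums_def)
  then show ?thesis
  proof cases
    case 1
    then show ?thesis
      by (rule greedy_partial_sums_conj_class)
  next
    case 2
    then have "(\<lambda>n. - f n) \<in> conj_class (conj_value (- x))"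
      by (rule greedy_partial_sums_conj_class)
    moreover have "x \<in> theta_adic a"
      using 2 theta_adic_uminus[of x a] by (auto simp: theta_adic_def)
    then have "conj_value (- x) = - conj_value x"
      using a_pos by (intro conj_value_uminus theta_adic_digit_bound)
    moreover have "(\<lambda>n. 0) \<in> conj_class 0"
      by (simp add: conj_class_def)
    ultimately show ?thesis
      using conj_class_diff[of "\<lambda>n. 0" 0 "\<lambda>n. - f n" "- conj_value x"] by simp
  qed
qed

text \<open>Negation swaps the two disjuncts of \<open>partial_sums\<close>; later arguments use
  this to reduce to greedy series.\<close>

lemma partial_sums_uminus:
  "partial_sums (quad_order \<theta>) \<theta> a (- x) (\<lambda>n. - f n) \<longleftrightarrow> partial_sums (quad_order \<theta>) \<theta> a x f"
proof -
  have "- y \<in> quad_order \<theta> \<longleftrightarrow> y \<in> quad_order \<theta>" for y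
    using quad_order_minus(1)[of y] quad_order_minus(1)[of "- y"] by auto
  then show ?thesis
    by (auto simp: partial_sums_def)
qed

lemma greedy_partial_sums_truncations:
  "greedy_partial_sums \<theta> a x (\<lambda>n. digit_sum \<theta> (fls_subdegree x) (int n) (fls_nth x))"
  unfolding greedy_partial_sums_def
proof (intro exI[of _ int] conjI allI)
  show "mono int"
    by (simp add: mono_def)
  show "filterlim int at_top sequentially"
    by (rule filterlim_int_sequentially)
  fix n
  show "\<exists>N d. greedy_poly a (int n + 1) N d \<and>
      digit_sum \<theta> (fls_subdegree x) (int n) (fls_nth x)
      = digit_sum \<theta> (fls_subdegree x) (int n) (fls_nth x) + digit_sum \<theta> (int n + 1) N d"
    using a_pos by (intro exI[of _ "0 :: int"] exI[of _ "\<lambda>_. 0"]) (auto simp: greedy_poly_def)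
qed

lemma partial_sums_exist:
  assumes "x \<in> theta_adic a"
  obtains f where "partial_sums (quad_order \<theta>) \<theta> a x f"
proof -
  have *: "\<exists>f. partial_sums (quad_order \<theta>) \<theta> a x f" if "x \<in> greedy_laurent a" for x
    using that greedy_partial_sums_truncations[of x] quad_order_digit_sum(1)
    unfolding partial_sums_def
    by (intro exI[of _ "\<lambda>n. digit_sum \<theta> (fls_subdegree x) (int n) (fls_nth x)"]) simp
  show thesis
  proof (cases "x \<in> greedy_laurent a")
    case True
    then show thesis using * that by blast
  next
    case False
    then obtain f where "partial_sums (quad_order \<theta>) \<theta> a (- x) f"
      using assms *[of "- x"] by (auto simp: theta_adic_def)
    then have "partial_sums (quad_order \<theta>) \<theta> a (- x) (\<lambda>n. - (- f n))"
      by simp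
    then show thesis
      unfolding partial_sums_uminus by (rule that)
  qed
qed

text \<open>All sequences of partial sums lie in one class, and since at least one such sequence
  exists and distinct classes are disjoint, no other class qualifies.\<close>

lemma theta_pi_eq:
  assumes "x \<in> theta_adic a"
  shows "theta_pi (quad_order \<theta>) \<theta> a x = conj_class (conj_value x)"
  unfolding theta_pi_def carrier_completion
proof (rule the_equality)
  show "conj_class (conj_value x) \<in> range conj_class \<and>
      (\<forall>f. partial_sums (quad_order \<theta>) \<theta> a x f \<longrightarrow> f \<in> conj_class (conj_value x))"
    using partial_sums_conj_class by blast
next
  fix c
  assume c: "c \<in> range conj_class \<and> (\<forall>f. partial_sums (quad_order \<theta>) \<theta> a x f \<longrightarrow> f \<in> c)"
  obtain f where "partial_sums (quad_order \<theta>) \<theta> a x f"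
    by (rule partial_sums_exist[OF assms])
  then show "c = conj_class (conj_value x)"
    using c conj_class_unique partial_sums_conj_class by blast
qed

lemma theta_conj_eq:
  assumes "x \<in> theta_adic a"
  shows "theta_conj (quad_order \<theta>) \<theta> a x = conj_value x"
  by (simp add: theta_conj_def theta_pi_eq[OF assms] completion_conj_eq)

section \<open>Extracting partial sums from bounded sequences\<close>

text \<open>A small lowest exponent forces a large conjugate. The bound \<open>C\<close> thus keeps
  all lowest exponents at or above a common \<open>- k\<close>, and padding with zeros lets every
  expansion start there.\<close>

lemma bounded_conj_common_exponent:
  fixes h :: "nat \<Rightarrow> real"
  assumes "\<And>n. h n \<in> quad_order \<theta>" "\<And>n. h n > 0" "\<And>n. \<bar>quad_conj \<theta> (h n)\<bar> \<le> C"
  obtains m :: int and M :: "nat \<Rightarrow> int" and b :: "nat \<Rightarrow> int \<Rightarrow> int"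
  where "\<forall>n. greedy_poly a m (M n) (b n) \<and> h n = digit_sum \<theta> m (M n) (b n)"
proof -
  obtain k where k: "C * \<theta> < \<theta> ^ k"
    using real_arch_pow[OF theta_gt_1] by blast
  have "\<exists>M b. greedy_poly a (- int k) M b \<and> h n = digit_sum \<theta> (- int k) M b" for n
  proof -
    obtain m M b where b: "greedy_poly a m M b" "b m \<noteq> 0" "h n = digit_sum \<theta> m M b"
      by (rule pos_greedy_expansion[OF assms(1)[of n] assms(2)[of n]])
    then have "greedy_expansion \<theta> a (h n) m"
      unfolding greedy_expansion_def by blast
    from greedy_expansion_conj_bounds(2)[OF this] have "\<theta> powi (- m) / \<theta> < C"
      using assms(3)[of n] by linarith
    then have "\<theta> powi (- m) < C * \<theta>"
      using theta_gt_1 by (simp add: field_simps)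
    also have "\<dots> < \<theta> powi int k"
      using k by simp
    finally have lt: "\<theta> powi (- m) < \<theta> powi int k" .
    have "- m < int k"
      by (rule power_int_le_imp_less_exp[OF theta_gt_1 lt]) simp
    then have m: "- int k \<le> m"
      by simp
    have "greedy_poly a (- int k) M b"
      using b(1) m by (auto simp: greedy_poly_def)
    moreover have "h n = digit_sum \<theta> (- int k) M b"
      unfolding b(3) using b(1) m by (intro digit_sum_lower[symmetric]) (auto simp: greedy_poly_def)
    ultimately show ?thesis by blast
  qed
  then obtain M b where
    "\<forall>n. greedy_poly a (- int k) (M n) (b n) \<and> h n = digit_sum \<theta> (- int k) (M n) (b n)"
    by metis
  then show thesis
    by (rule that)
qed

text \<open>Compactness of the digit sequences: along a diagonal subsequence the digits stabilise to
  those of a series \<open>w\<close>. The \<open>k\<close>-th term then agrees with \<open>w\<close>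
  up to degree \<open>m + k\<close>, and its remaining digits form the permitted correction.\<close>

lemma pos_bounded_conj_partial_sums:
  fixes h :: "nat \<Rightarrow> real"
  assumes "\<And>n. h n \<in> quad_order \<theta>" "\<And>n. h n > 0" "\<And>n. \<bar>quad_conj \<theta> (h n)\<bar> \<le> C"
  obtains \<phi> w where "strict_mono \<phi>" "w \<in> theta_adic a"
    "partial_sums (quad_order \<theta>) \<theta> a w (h \<circ> \<phi>)"
proof -
  obtain m M b where "\<forall>n. greedy_poly a m (M n) (b n) \<and> h n = digit_sum \<theta> m (M n) (b n)"
    by (rule bounded_conj_common_exponent[where h = h and C = C, OF assms])
  then have b: "\<And>n. greedy_poly a m (M n) (b n)" "\<And>n. h n = digit_sum \<theta> m (M n) (b n)"
    by auto
  have "finite (range (\<lambda>n. b n (m + int i)))" for i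
    by (rule finite_subset[of _ "{0..a}"]) (use b in \<open>auto simp: greedy_poly_def\<close>)
  then obtain \<phi> c where \<phi>: "strict_mono \<phi>" "\<And>k i. i \<le> k \<Longrightarrow> b (\<phi> k) (m + int i) = c i"
    using subseq_stable_values[of "\<lambda>n i. b n (m + int i)"] by blast
  define w where "w = Abs_fls (\<lambda>i. if i < m then 0 else c (nat (i - m)))"
  have wn: "fls_nth w i = (if i < m then 0 else c (nat (i - m)))" for i
    unfolding w_def by (subst nth_Abs_fls_lower_bound[of m]) auto
  have wb: "fls_nth w i = b (\<phi> k) i" if "i \<le> m + int k" for i k
  proof (cases "i < m")
    case True
    then show ?thesis
      using b(1)[of "\<phi> k"] by (simp add: wn greedy_poly_def)
  next
    case False
    then show ?thesis
      using \<phi>(2)[of "nat (i - m)" k] that by (simp add: wn)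
  qed
  have gd: "greedy_digits a (b n)" for n
    using b(1) by (simp add: greedy_poly_iff)
  have w: "w \<in> greedy_laurent a"
    unfolding greedy_laurent_iff[OF a_pos] greedy_digits_def
  proof
    fix i
    \<comment> \<open>The two neighbouring digits of \<open>w\<close> are read off from one and the
      same expansion, from which greediness is inherited.\<close>
    have "i \<le> m + int (nat (i - m))" "i - 1 \<le> m + int (nat (i - m))"
      by auto
    from wb[OF this(1)] wb[OF this(2)]
    show "fls_nth w i \<in> {0..a} \<and> (fls_nth w i = a \<longrightarrow> fls_nth w (i - 1) = 0)"
      using gd by (simp add: greedy_digits_def)
  qed
  have "greedy_partial_sums \<theta> a w (h \<circ> \<phi>)"
    unfolding greedy_partial_sums_def
  proof (intro exI[of _ "\<lambda>k. m + int k"] conjI allI)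
    show "mono (\<lambda>k. m + int k)"
      by (simp add: mono_def)
    show "filterlim (\<lambda>k. m + int k) at_top sequentially"
      unfolding filterlim_at_top
    proof
      fix Z
      show "eventually (\<lambda>k. Z \<le> m + int k) sequentially"
        by (rule eventually_sequentiallyI[of "nat (Z - m)"]) linarith
    qed
    fix k
    define K where "K = m + int k"
    \<comment> \<open>The maximum allows a split at \<open>K\<close> even when the expansion ends
      below that degree.\<close>
    define N where "N = max (M (\<phi> k)) K"
    define d where "d i = (if i > K then b (\<phi> k) i else 0)" for i
    have "greedy_poly a (K + 1) N d"
      using b(1)[of "\<phi> k"] a_pos by (auto simp: greedy_poly_def d_def N_def le_max_iff_disj)
    moreover have "(h \<circ> \<phi>) k = digit_sum \<theta> (fls_subdegree w) K (fls_nth w) + digit_sum \<theta> (K + 1) N d"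
    proof -
      have "(h \<circ> \<phi>) k = digit_sum \<theta> m N (b (\<phi> k))"
        unfolding comp_def b(2) using b(1)[of "\<phi> k"]
        by (intro digit_sum_upper[symmetric]) (auto simp: N_def greedy_poly_def)
      also have "\<dots> = digit_sum \<theta> m K (b (\<phi> k)) + digit_sum \<theta> (K + 1) N (b (\<phi> k))"
        by (rule digit_sum_split) (auto simp: K_def N_def)
      also have "digit_sum \<theta> (K + 1) N (b (\<phi> k)) = digit_sum \<theta> (K + 1) N d"
        by (rule digit_sum_cong) (auto simp: d_def)
      also have "digit_sum \<theta> m K (b (\<phi> k)) = digit_sum \<theta> m K (fls_nth w)"
        by (rule digit_sum_cong) (auto simp: K_def wb)
      also have "\<dots> = digit_sum \<theta> (fls_subdegree w) K (fls_nth w)"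
      \<comment> \<open>For \<open>w = 0\<close> the subdegree is a default value unrelated to
        \<open>m\<close>, but every term vanishes.\<close>
      proof (cases "w = 0")
        case True
        then show ?thesis
          by (simp add: digit_sum_def)
      next
        case False
        then have "m \<le> fls_subdegree w"
          by (intro fls_subdegree_geI) (auto simp: wn)
        then show ?thesis
          by (intro digit_sum_lower) auto
      qed
      finally show ?thesis .
    qed
    ultimately show "\<exists>N d. greedy_poly a (m + int k + 1) N d \<and>
        (h \<circ> \<phi>) k = digit_sum \<theta> (fls_subdegree w) (m + int k) (fls_nth w)
          + digit_sum \<theta> (m + int k + 1) N d"
      unfolding K_def by blast
  qed
  with w assms(1) have "partial_sums (quad_order \<theta>) \<theta> a w (h \<circ> \<phi>)"
    by (simp add: partial_sums_def)
  moreover have "w \<in> theta_adic a"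
    using w by (simp add: theta_adic_def)
  ultimately show thesis
    using \<phi>(1) that by blast
qed

text \<open>One of the three signs occurs infinitely often. Zeros are truncations of the zero
  series, and negative terms are handled by negation.\<close>

lemma bounded_conj_partial_sums:
  fixes h :: "nat \<Rightarrow> real"
  assumes "\<And>n. h n \<in> quad_order \<theta>" "\<And>n. \<bar>quad_conj \<theta> (h n)\<bar> \<le> C"
  obtains \<phi> w where "strict_mono \<phi>" "w \<in> theta_adic a"
    "partial_sums (quad_order \<theta>) \<theta> a w (h \<circ> \<phi>)"
proof -
  have "UNIV = {n. h n = 0} \<union> {n. h n > 0} \<union> {n. h n < 0}"
    by auto
  then consider "infinite {n. h n = 0}" | "infinite {n. h n > 0}" | "infinite {n. h n < 0}"
    by (metis finite_Un infinite_UNIV_nat)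
  then show thesis
  proof cases
    case 1
    then obtain \<phi> :: "nat \<Rightarrow> nat" where \<phi>: "strict_mono \<phi>" "\<And>n. h (\<phi> n) = 0"
      using infinite_enumerate by blast
    have zero: "0 \<in> greedy_laurent a"
      using a_pos by (simp add: greedy_laurent_iff greedy_digits_def)
    have "h \<circ> \<phi> = (\<lambda>n. digit_sum \<theta> (fls_subdegree (0 :: int fls)) (int n) (fls_nth 0))"
      by (simp add: \<phi> fun_eq_iff digit_sum_def)
    then have "greedy_partial_sums \<theta> a 0 (h \<circ> \<phi>)"
      using greedy_partial_sums_truncations[of 0] by (simp only:)
    with zero have "partial_sums (quad_order \<theta>) \<theta> a 0 (h \<circ> \<phi>)"
      by (simp add: partial_sums_def \<phi>)
    with \<phi> zero show thesis
      by (intro that[of \<phi> 0]) (auto simp: theta_adic_def)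
  next
    case 2
    then obtain \<phi> :: "nat \<Rightarrow> nat" where \<phi>: "strict_mono \<phi>" "\<And>n. h (\<phi> n) > 0"
      using infinite_enumerate by blast
    obtain \<psi> w where "strict_mono \<psi>" "w \<in> theta_adic a"
      "partial_sums (quad_order \<theta>) \<theta> a w ((h \<circ> \<phi>) \<circ> \<psi>)"
      using pos_bounded_conj_partial_sums[of "h \<circ> \<phi>" C] \<phi> assms by auto
    then show thesis
      using that[of "\<phi> \<circ> \<psi>" w] \<phi> by (auto simp: strict_mono_o comp_assoc)
  next
    case 3
    then obtain \<phi> :: "nat \<Rightarrow> nat" where \<phi>: "strict_mono \<phi>" "\<And>n. h (\<phi> n) < 0"
      using infinite_enumerate by blast
    obtain \<psi> w where \<psi>: "strict_mono \<psi>" "w \<in> theta_adic a"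
      "partial_sums (quad_order \<theta>) \<theta> a w ((\<lambda>n. - h (\<phi> n)) \<circ> \<psi>)"
      using pos_bounded_conj_partial_sums[of "\<lambda>n. - h (\<phi> n)" C] \<phi> assms
      by (auto simp: quad_order_minus)
    have "partial_sums (quad_order \<theta>) \<theta> a (- (- w)) (\<lambda>n. - (h \<circ> (\<phi> \<circ> \<psi>)) n)"
      using \<psi>(3) by (simp add: comp_def)
    then have "partial_sums (quad_order \<theta>) \<theta> a (- w) (h \<circ> (\<phi> \<circ> \<psi>))"
      unfolding partial_sums_uminus .
    then show thesis
      using that[of "\<phi> \<circ> \<psi>" "- w"] \<phi> \<psi> by (auto simp: strict_mono_o theta_adic_uminus)
  qed
qed

text \<open>Convergence supplies the bound for the extraction. The extracted subsequence keeps the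
  limit \<open>r\<close>, which forces the value of \<open>w\<close>; surjectivity and nonemptiness
  of sums and products all rest on this.\<close>

lemma conj_class_partial_sums:
  assumes "h \<in> conj_class r"
  obtains \<phi> w where "strict_mono \<phi>" "w \<in> theta_adic a"
    "partial_sums (quad_order \<theta>) \<theta> a w (h \<circ> \<phi>)" "conj_value w = r"
proof -
  have "Bseq (\<lambda>n. quad_conj \<theta> (h n))"
    using assms by (auto simp: conj_class_def intro: convergent_imp_Bseq convergentI)
  then obtain C where "\<And>n. \<bar>quad_conj \<theta> (h n)\<bar> \<le> C"
    by (auto simp: Bseq_def)
  moreover have "\<And>n. h n \<in> quad_order \<theta>"
    using assms by (simp add: conj_class_def)
  ultimately obtain \<phi> w where w: "strict_mono \<phi>" "w \<in> theta_adic a"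
      "partial_sums (quad_order \<theta>) \<theta> a w (h \<circ> \<phi>)"
    using bounded_conj_partial_sums[of h C] by blast
  have "conj_value w = r"
    using conj_class_unique partial_sums_conj_class[OF w(3)] conj_class_subseq[OF assms w(1)]
    by blast
  with w show thesis
    by (rule that)
qed

section \<open>Surjectivity and the multioperations, in terms of values\<close>

lemma conj_value_surj: "conj_value ` theta_adic a = UNIV"
proof -
  have "r \<in> conj_value ` theta_adic a" for r
  proof -
    obtain h where "h \<in> conj_class r"
      using conj_class_nonempty by blast
    then obtain \<phi> w where "w \<in> theta_adic a" "conj_value w = r"
      by (rule conj_class_partial_sums)
    then show ?thesis
      by blast
  qed
  then show ?thesis by blast
qed

text \<open>Uniqueness of the value is additivity of limits. For existence, one subsequence is
  chosen along which the sums become partial sums of some \<open>w\<close>; the same subsequence of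
  \<open>f\<close> and of \<open>g\<close> still consists of partial sums of \<open>x\<close> and of
  \<open>y\<close>.\<close>

lemma conj_value_multi_add:
  assumes "x \<in> theta_adic a" "y \<in> theta_adic a"
  shows "conj_value ` multi_add (quad_order \<theta>) \<theta> a x y = {conj_value x + conj_value y}"
proof -
  have "\<forall>w \<in> multi_add (quad_order \<theta>) \<theta> a x y. conj_value w = conj_value x + conj_value y"
    unfolding multi_add_def
    by (auto dest!: partial_sums_conj_class intro: conj_class_unique conj_class_add)
  moreover have "multi_add (quad_order \<theta>) \<theta> a x y \<noteq> {}"
  proof -
    obtain f where f: "partial_sums (quad_order \<theta>) \<theta> a x f"
      by (rule partial_sums_exist[OF assms(1)])
    obtain g where g: "partial_sums (quad_order \<theta>) \<theta> a y g"
      by (rule partial_sums_exist[OF assms(2)])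
    have "(\<lambda>n. f n + g n) \<in> conj_class (conj_value x + conj_value y)"
      by (intro conj_class_add partial_sums_conj_class f g)
    then obtain \<phi> w where w: "strict_mono \<phi>" "w \<in> theta_adic a"
      "partial_sums (quad_order \<theta>) \<theta> a w ((\<lambda>n. f n + g n) \<circ> \<phi>)"
      by (rule conj_class_partial_sums)
    have "w \<in> multi_add (quad_order \<theta>) \<theta> a x y"
      unfolding multi_add_def
      using w partial_sums_subseq[OF f w(1)] partial_sums_subseq[OF g w(1)]
      by (auto simp: comp_def)
    then show ?thesis by blast
  qed
  ultimately show ?thesis
    by (simp add: image_constant_conv cong: image_cong)
qed

lemma conj_value_multi_mult:
  assumes "x \<in> theta_adic a" "y \<in> theta_adic a"
  shows "conj_value ` multi_mult (quad_order \<theta>) \<theta> a x y = {conj_value x * conj_value y}"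
proof -
  have "\<forall>w \<in> multi_mult (quad_order \<theta>) \<theta> a x y. conj_value w = conj_value x * conj_value y"
    unfolding multi_mult_def
    by (auto dest!: partial_sums_conj_class intro: conj_class_unique conj_class_mult)
  moreover have "multi_mult (quad_order \<theta>) \<theta> a x y \<noteq> {}"
  proof -
    obtain f where f: "partial_sums (quad_order \<theta>) \<theta> a x f"
      by (rule partial_sums_exist[OF assms(1)])
    obtain g where g: "partial_sums (quad_order \<theta>) \<theta> a y g"
      by (rule partial_sums_exist[OF assms(2)])
    have "(\<lambda>n. f n * g n) \<in> conj_class (conj_value x * conj_value y)"
      by (intro conj_class_mult partial_sums_conj_class f g)
    then obtain \<phi> w where w: "strict_mono \<phi>" "w \<in> theta_adic a"
      "partial_sums (quad_order \<theta>) \<theta> a w ((\<lambda>n. f n * g n) \<circ> \<phi>)"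
      by (rule conj_class_partial_sums)
    have "w \<in> multi_mult (quad_order \<theta>) \<theta> a x y"
      unfolding multi_mult_def
      using w partial_sums_subseq[OF f w(1)] partial_sums_subseq[OF g w(1)]
      by (auto simp: comp_def)
    then show ?thesis by blast
  qed
  ultimately show ?thesis
    by (simp add: image_constant_conv cong: image_cong)
qed

section \<open>Transfer to \<open>theta_pi\<close> and \<open>theta_conj\<close>, and identification
  of the ring\<close>

lemma theta_pi_image:
  assumes "S \<subseteq> theta_adic a"
  shows "theta_pi (quad_order \<theta>) \<theta> a ` S = conj_class ` conj_value ` S"
  unfolding image_image by (rule image_cong) (use assms theta_pi_eq in auto)

lemma theta_conj_image:
  assumes "S \<subseteq> theta_adic a"
  shows "theta_conj (quad_order \<theta>) \<theta> a ` S = conj_value ` S"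
  by (rule image_cong) (use assms theta_conj_eq in auto)

lemma quad_order_subset_ring_of_integers: "quad_order \<theta> \<subseteq> ring_of_integers \<theta>"
proof
  fix x
  assume "x \<in> quad_order \<theta>"
  then obtain u v where x: "x = of_int u + of_int v * \<theta>"
    by (rule quad_orderE)
  have "x = of_rat (of_int u) + of_rat (of_int v) * \<theta>"
    by (simp add: x)
  then have "x \<in> quad_field \<theta>"
    unfolding quad_field_def by blast
  \<comment> \<open>The characteristic polynomial of \<open>x\<close>: its trace is
    \<open>2 * u + v * a\<close> and its norm is
    \<open>u\<^sup>2 + u * v * a - v\<^sup>2\<close>.\<close>
  define p :: "real poly" where
    "p = [:of_int (u\<^sup>2 + u * v * a - v\<^sup>2), of_int (- (2 * u + v * a)), 1:]"
  have "poly p x = of_int v ^ 2 * (\<theta>\<^sup>2 - of_int a * \<theta> - 1)"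
    by (simp add: p_def x algebra_simps power2_eq_square)
  then have "poly p x = 0"
    using theta_square by simp
  moreover have "\<forall>i. coeff p i \<in> \<int>"
    by (auto simp: p_def coeff_pCons split: nat.splits)
  ultimately have "algebraic_int x"
    by (intro algebraic_int.intros[of p]) (auto simp: p_def)
  with \<open>x \<in> quad_field \<theta>\<close> show "x \<in> ring_of_integers \<theta>"
    by (simp add: ring_of_integers_def)
qed

end

theorem theorem18:
  fixes \<theta> :: real and a :: int and A :: "real set"
  assumes "a \<ge> 1" and "\<theta> > 1" and "\<theta>\<^sup>2 = of_int a * \<theta> + 1"
    and "A = ring_of_integers \<theta> \<and> (\<forall>\<alpha>\<in>A. \<alpha> \<noteq> 0 \<longrightarrow> (\<exists>m. greedy_expansion \<theta> a \<alpha> m))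
         \<or> A = quad_order \<theta>"
  shows "theta_pi A \<theta> a ` theta_adic a = carrier (completion A \<theta> a)
    \<and> theta_conj A \<theta> a ` theta_adic a = (UNIV :: real set)
    \<and> (\<forall>x\<in>theta_adic a. \<forall>y\<in>theta_adic a.
          theta_pi A \<theta> a ` multi_add A \<theta> a x y
            = {theta_pi A \<theta> a x \<oplus>\<^bsub>completion A \<theta> a\<^esub> theta_pi A \<theta> a y}
        \<and> theta_pi A \<theta> a ` multi_mult A \<theta> a x y
            = {theta_pi A \<theta> a x \<otimes>\<^bsub>completion A \<theta> a\<^esub> theta_pi A \<theta> a y}
        \<and> theta_conj A \<theta> a ` multi_add A \<theta> a x y
            = {theta_conj A \<theta> a x + theta_conj A \<theta> a y}
        \<and> theta_conj A \<theta> a ` multi_mult A \<theta> a x y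
            = {theta_conj A \<theta> a x * theta_conj A \<theta> a y})"
proof -
  interpret quadratic_unit \<theta> a
    by unfold_locales (use assms in auto)
  \<comment> \<open>Numbers with a greedy expansion lie in \<open>quad_order \<theta>\<close>, so
    the first alternative can only hold when the ring of integers equals that order. Both
    alternatives thus concern the same ring.\<close>
  have A: "A = quad_order \<theta>"
  proof (rule disjE[OF assms(4)])
    assume A: "A = ring_of_integers \<theta> \<and> (\<forall>\<alpha>\<in>A. \<alpha> \<noteq> 0 \<longrightarrow> (\<exists>m. greedy_expansion \<theta> a \<alpha> m))"
    have "\<alpha> \<in> quad_order \<theta>" if "\<alpha> \<in> A" for \<alpha>
      using A that greedy_expansion_conj_bounds(1) by (cases "\<alpha> = 0") auto
    with A show ?thesis
      using quad_order_subset_ring_of_integers by blast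
  qed
  have "multi_add A \<theta> a x y \<subseteq> theta_adic a" "multi_mult A \<theta> a x y \<subseteq> theta_adic a" for x y
    by (auto simp: multi_add_def multi_mult_def)
  moreover have "theta_pi (quad_order \<theta>) \<theta> a ` theta_adic a = carrier (completion (quad_order \<theta>) \<theta> a)"
    by (simp only: theta_pi_image[OF order_refl] conj_value_surj carrier_completion)
  ultimately show ?thesis
    unfolding A
    by (simp add: theta_pi_image theta_conj_image theta_pi_eq theta_conj_eq conj_value_surj
        conj_value_multi_add conj_value_multi_mult completion_add completion_mult)
qed

end
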